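(* Under the setting described in the context (in particular, assuming $M_W<\infty$ and $C'_W<\infty$, but not assuming any bound on $\partial w/\partial y$), the map $G:\Theta_T\to\Theta_T$ has a fixed point.
   Context: Fix $T>0$. Let $W\subset C^1([0,1]\times[0,T];[0,\infty))$ be a set of non-negative $C^1$ functions $w(y,t)$, with Borel $\sigma$-algebra from the supremum norm $\|w\|=\sup_{(y,t)\in[0,1]\times[0,T]}|w(y,t)|$. Let $\lambda$ be a Borel probability measure on $W$ with $M_W:=\int_W\|w\|\lambda(dw)<\infty$ and \[C'_W:=\sup_{w\in W}\sup_{(y,t),(y',t')\in[0,1]\times[0,T]}|w(y,t)-w(y',t')|<\infty.\] Let $\sigma\ge0$ be measurable on $W\times[0,1]$ with $\int_W\sigma(w,y)\lambda(dw)=1$ for all $y\in[0,1]$ and $\int_0^1\sigma(w,z)dz=1$ for all $w\in W$. Let $\Gamma_b=\{(0,s):0\le s\le T\}$, $\Gamma_i=\{(z,0):0\le z\le1\}$, $\Gamma=\Gamma_b\cup\Gamma_i$, $\Gamma_t=\Gamma_i\cup\{(0,s):0\le s\le t\}$, $\Delta_T=\{(\gamma,t)\in\Gamma\times[0,T]:\gamma\in\Gamma_t\}$. Totally order $\Gamma$ by: for $s\le t$ and $z\le y$, $(0,T)\succeq(0,t)\succeq(0,s)\succeq(0,0)\succeq(z,0)\succeq(y,0)\succeq(1,0)$. The set $\Theta_T$ consists of all continuous $\theta:\Delta_T\to[0,1]$ with $\theta((y_0,t_0),t_0)=y_0$ for $(y_0,t_0)\in\Gamma$, such that for each $t$ the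 map $\theta(\cdot,t):\Gamma_t\to[0,1]$ is surjective and non-increasing with respect to $\succeq$, and for each $\gamma$, $\theta(\gamma,t)$ is non-decreasing in $t$. For $\theta\in\Theta_T$, $w\in W$, $z\in[0,1)$ put $\Omega_{\theta,w,z}(0,t)=\int_0^tw(\theta((z,0),u),u)\,du$ and $\Omega_{\theta,w}(s,t)=\int_s^tw(\theta((0,s),u),u)\,du$ for $0<s\le t$. Define $G(\theta)$ on $\Delta_T$ by \[G(\theta)((y_0,0),t)=1-\int_{W\times[y_0,1)}e^{-\Omega_{\theta,w,z}(0,t)}\sigma(w,z)\,\lambda(dw)\,dz,\quad y_0\in[0,1],\] and, for $0\le t_0\le t\le T$, \[\begin{aligned}G(\theta)((0,t_0),t)=\;&1-\int_{W\times[0,1)}e^{-\Omega_{\theta,w,z}(0,t)}\sigma(w,z)\lambda(dw)dz\\&-\int_{W\times[0,1)}\sum_{k\ge1}\int_{0\le u_1\le\cdots\le u_k\le t_0}w(\theta((z,0),u_1),u_1)e^{-\Omega_{\theta,w,z}(0,u_1)}\\&\qquad\times\prod_{i=2}^k\Bigl(w(\theta((0,u_{i-1}),u_i),u_i)e^{-\Omega_{\theta,w}(u_{i-1},u_i)}\Bigr)e^{-\Omega_{\theta,w}(u_k,t)}\,du_1\cdots du_k\;\sigma(w,z)\lambda(dw)dz.\end{aligned}\] Under these assumptions $G$ maps $\Theta_T$ into $\Theta_T$. *)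

theory Defs
  imports "HOL-Probability.Probability"
begin

text \<open>Functions w(y,t) are represented as maps on pairs (y,t).\<close>

definition rect :: "real \<Rightarrow> (real \<times> real) set" where
  "rect T = {0..1} \<times> {0..T}"

definition supn :: "real \<Rightarrow> (real \<times> real \<Rightarrow> real) \<Rightarrow> real" where
  "supn T w = (SUP p\<in>rect T. \<bar>w p\<bar>)"

definition C1_on :: "(real \<times> real) set \<Rightarrow> (real \<times> real \<Rightarrow> real) \<Rightarrow> bool" where
  "C1_on S f \<longleftrightarrow> (\<exists>D :: real \<times> real \<Rightarrow> real \<times> real. continuous_on S D \<and>
      (\<forall>x\<in>S. (f has_derivative (\<lambda>h. D x \<bullet> h)) (at x within S)))"

definition supopen :: "real \<Rightarrow> (real \<times> real \<Rightarrow> real) set \<Rightarrow> (real \<times> real \<Rightarrow> real) set \<Rightarrow> bool" where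
  "supopen T W U \<longleftrightarrow> U \<subseteq> W \<and>
     (\<forall>w\<in>U. \<exists>e>0. \<forall>v\<in>W. supn T (\<lambda>p. v p - w p) < e \<longrightarrow> v \<in> U)"

definition Gam :: "real \<Rightarrow> (real \<times> real) set" where
  "Gam T = {(0, s) | s. 0 \<le> s \<and> s \<le> T} \<union> {(z, 0) | z. 0 \<le> z \<and> z \<le> 1}"

definition Gam_t :: "real \<Rightarrow> (real \<times> real) set" where
  "Gam_t t = {(z, 0) | z. 0 \<le> z \<and> z \<le> 1} \<union> {(0, s) | s. 0 \<le> s \<and> s \<le> t}"

definition Delta :: "real \<Rightarrow> ((real \<times> real) \<times> real) set" where
  "Delta T = {(\<gamma>, t). t \<in> {0..T} \<and> \<gamma> \<in> Gam_t t}"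

text \<open>The total order on Gamma: (0,s) has rank s, (z,0) has rank -z;
  on Gamma the rank of (y,s) is s - y.  gge g g' means g \<succeq> g'.\<close>
definition grank :: "real \<times> real \<Rightarrow> real" where
  "grank p = snd p - fst p"

definition gge :: "real \<times> real \<Rightarrow> real \<times> real \<Rightarrow> bool" where
  "gge g g' \<longleftrightarrow> grank g' \<le> grank g"

definition Theta :: "real \<Rightarrow> ((real \<times> real) \<times> real \<Rightarrow> real) set" where
  "Theta T = {\<theta>. continuous_on (Delta T) \<theta>
     \<and> (\<forall>p\<in>Delta T. \<theta> p \<in> {0..1})
     \<and> (\<forall>y0 t0. (y0, t0) \<in> Gam T \<longrightarrow> \<theta> ((y0, t0), t0) = y0)
     \<and> (\<forall>t\<in>{0..T}. (\<lambda>\<gamma>. \<theta> (\<gamma>, t)) ` Gam_t t = {0..1})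
     \<and> (\<forall>t\<in>{0..T}. \<forall>\<gamma>\<in>Gam_t t. \<forall>\<gamma>'\<in>Gam_t t. gge \<gamma> \<gamma>' \<longrightarrow> \<theta> (\<gamma>, t) \<le> \<theta> (\<gamma>', t))
     \<and> (\<forall>\<gamma> t t'. (\<gamma>, t) \<in> Delta T \<and> (\<gamma>, t') \<in> Delta T \<and> t \<le> t' \<longrightarrow> \<theta> (\<gamma>, t) \<le> \<theta> (\<gamma>, t'))}"

definition Om_z :: "((real \<times> real) \<times> real \<Rightarrow> real) \<Rightarrow> (real \<times> real \<Rightarrow> real) \<Rightarrow> real \<Rightarrow> real \<Rightarrow> real" where
  "Om_z \<theta> w z t = integral {0..t} (\<lambda>u. w (\<theta> ((z, 0), u), u))"

definition Om :: "((real \<times> real) \<times> real \<Rightarrow> real) \<Rightarrow> (real \<times> real \<Rightarrow> real) \<Rightarrow> real \<Rightarrow> real \<Rightarrow> real" where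
  "Om \<theta> w s t = integral {s..t} (\<lambda>u. w (\<theta> ((0, s), u), u))"

text \<open>Ordered simplex 0 <= u_1 <= ... <= u_k <= t0 (0-indexed: u 0, ..., u (k-1)).\<close>
definition osimplex :: "nat \<Rightarrow> real \<Rightarrow> (nat \<Rightarrow> real) set" where
  "osimplex k t0 = {u. 0 \<le> u 0 \<and> (\<forall>i. Suc i < k \<longrightarrow> u i \<le> u (Suc i)) \<and> u (k - 1) \<le> t0}"

definition prodf :: "((real \<times> real) \<times> real \<Rightarrow> real) \<Rightarrow> (real \<times> real \<Rightarrow> real) \<Rightarrow> real \<Rightarrow> real
     \<Rightarrow> nat \<Rightarrow> (nat \<Rightarrow> real) \<Rightarrow> real" where
  "prodf \<theta> w z t k u =
     w (\<theta> ((z, 0), u 0), u 0) * exp (- Om_z \<theta> w z (u 0))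
     * (\<Prod>i\<in>{1..<k}. w (\<theta> ((0, u (i - 1)), u i), u i) * exp (- Om \<theta> w (u (i - 1)) (u i)))
     * exp (- Om \<theta> w (u (k - 1)) t)"

definition termk :: "((real \<times> real) \<times> real \<Rightarrow> real) \<Rightarrow> (real \<times> real \<Rightarrow> real) \<Rightarrow> real \<Rightarrow> real
     \<Rightarrow> real \<Rightarrow> nat \<Rightarrow> ennreal" where
  "termk \<theta> w z t0 t k =
     (\<integral>\<^sup>+ u. indicator (osimplex k t0) u * ennreal (prodf \<theta> w z t k u) \<partial>(\<Pi>\<^sub>M i\<in>{..<k}. lborel))"

definition Gmap :: "(real \<times> real \<Rightarrow> real) measure \<Rightarrow> ((real \<times> real \<Rightarrow> real) \<Rightarrow> real \<Rightarrow> real)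
     \<Rightarrow> ((real \<times> real) \<times> real \<Rightarrow> real) \<Rightarrow> (real \<times> real) \<times> real \<Rightarrow> real" where
  "Gmap lam sig \<theta> p = (case p of ((y0, t0), t) \<Rightarrow>
     (if t0 = 0 then
        1 - enn2real (\<integral>\<^sup>+ q. indicator (space lam \<times> {y0..<1}) q
              * ennreal (exp (- Om_z \<theta> (fst q) (snd q) t) * sig (fst q) (snd q)) \<partial>(lam \<Otimes>\<^sub>M lborel))
      else
        1 - enn2real (\<integral>\<^sup>+ q. indicator (space lam \<times> {0..<1}) q
              * ennreal (exp (- Om_z \<theta> (fst q) (snd q) t) * sig (fst q) (snd q)) \<partial>(lam \<Otimes>\<^sub>M lborel))
          - enn2real (\<integral>\<^sup>+ q. indicator (space lam \<times> {0..<1}) q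
              * (\<Sum>k. termk \<theta> (fst q) (snd q) t0 t (Suc k)) * ennreal (sig (fst q) (snd q))
              \<partial>(lam \<Otimes>\<^sub>M lborel))))"

end

theory Submission
  imports Defs "HOL-Complex_Analysis.Great_Picard"
begin

text \<open>
  Follow a particle of type \<open>w\<close> that starts at \<open>z\<close>: it jumps first at rate \<open>w(\<theta>((z, 0), u), u)\<close> and,
  after a jump at time \<open>s\<close>, at rate \<open>w(\<theta>((0, s), u), u)\<close>. Then \<open>1 - G(\<theta>)((y\<^sub>0, t\<^sub>0), t)\<close> is the
  probability that \<open>z \<ge> y\<^sub>0\<close> and that no jump occurs in \<open>(t\<^sub>0, t]\<close>, when \<open>(w, z)\<close> has density \<open>\<sigma>\<close>. Since the
  jump intensity is at most \<open>\<parallel>w\<parallel>\<close>, this probability is Lipschitz in \<open>(y\<^sub>0, t\<^sub>0, t)\<close> with constant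
  \<open>1 + 2 M\<^sub>W\<close>, uniformly in \<open>\<theta>\<close>, and it depends continuously on \<open>\<theta>\<close> and only on the values of \<open>\<theta>\<close> at
  times up to \<open>t\<close>. By this causality, the equation in which \<open>\<theta>\<close> enters with a time delay
  \<open>d > 0\<close> is solved by finitely many iterations, as in Tonelli's proof of Peano's theorem; the solutions
  are equi-Lipschitz, and by Arzela-Ascoli a subsequence for \<open>d \<rightarrow> 0\<close> converges to a fixed point of \<open>G\<close>.
\<close>

section \<open>Survival functions\<close>

text \<open>No bound on the derivative of \<open>w\<close> in \<open>y\<close> is uniform over
  \<open>W\<close>, so a difference of two \<open>\<theta>\<close> yields no proportional difference
  of the rates: a contraction argument is not at hand, and compactness has to supply the fixed
  point. The delay lets approximate solutions be computed instead of being taken from a topological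
  fixed point theorem. The second obstacle is that only the first moment of the supremum norm of
  \<open>w\<close> is finite under \<open>lam\<close>. Estimating the series over the number of
  jumps term by term costs factors exponential in that norm, and these need not be integrable. Such
  bounds are therefore used for one particle at a time, to get finiteness and dominated convergence.
  What is integrated over all particles is either a probability or linear in the norm. The linear
  bounds come from a renewal argument: the density of a further jump at \<open>u\<close> is at most
  the norm times the probability of the number of jumps made so far, and these probabilities add up
  to 1. The two normalizations of \<open>sig\<close> give the initial law the marginals
  \<open>lam\<close> and Lebesgue measure, the origin of \<open>M_W\<close> and of 1 in the
  Lipschitz constant.\<close>

definition surv :: "(real \<Rightarrow> real) \<Rightarrow> real \<Rightarrow> real \<Rightarrow> real" where
  "surv f s t = exp (- integral {s..t} f)"

text \<open>Density of the time of jump \<open>k + 1\<close>: the index counts the jumps made before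
  the one at \<open>u\<close>. With values in \<open>ennreal\<close>, Tonelli and series can be used
  before any finiteness is known.\<close>

primrec jump_density :: "(real \<Rightarrow> real) \<Rightarrow> (real \<Rightarrow> real \<Rightarrow> real) \<Rightarrow> nat \<Rightarrow> real \<Rightarrow> ennreal" where
  "jump_density \<alpha> \<beta> 0 u = ennreal (\<alpha> u * surv \<alpha> 0 u)"
| "jump_density \<alpha> \<beta> (Suc k) u =
    (\<integral>\<^sup>+s. indicator {0..u} s * (jump_density \<alpha> \<beta> k s * ennreal (\<beta> s u * surv (\<beta> s) s u)) \<partial>lborel)"

text \<open>The probability that jump \<open>k + 1\<close> occurs by time \<open>t0\<close> and is the last one before \<open>t\<close>.\<close>

definition last_jump_before :: "(real \<Rightarrow> real) \<Rightarrow> (real \<Rightarrow> real \<Rightarrow> real) \<Rightarrow> nat \<Rightarrow> real \<Rightarrow> real \<Rightarrow> ennreal" where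
  "last_jump_before \<alpha> \<beta> k t0 t =
    (\<integral>\<^sup>+u. indicator {0..t0} u * (jump_density \<alpha> \<beta> k u * ennreal (surv (\<beta> u) u t)) \<partial>lborel)"

text \<open>\<open>enn2real\<close> would turn an infinite series into 0; for
  \<open>0 \<le> t0 \<le> t\<close> this is excluded by
  \<open>suminf_last_jump_before_finite\<close>.\<close>

definition no_jump_since :: "(real \<Rightarrow> real) \<Rightarrow> (real \<Rightarrow> real \<Rightarrow> real) \<Rightarrow> real \<Rightarrow> real \<Rightarrow> real" where
  "no_jump_since \<alpha> \<beta> t0 t = surv \<alpha> 0 t + enn2real (\<Sum>k. last_jump_before \<alpha> \<beta> k t0 t)"

lemma surv_nonneg [simp]: "0 \<le> surv f s t"
  by (simp add: surv_def)

lemma surv_refl [simp]: "surv f s s = 1"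
  by (simp add: surv_def)

lemma surv_cong: "(\<And>u. s \<le> u \<Longrightarrow> u \<le> t \<Longrightarrow> f u = g u) \<Longrightarrow> surv f s t = surv g s t"
  unfolding surv_def by (intro arg_cong[where f=exp] arg_cong[where f=uminus] integral_cong) auto

text \<open>Moving the limits of integration into an indicator gives a Lebesgue integral over a
  fixed domain, ready for measurability in parameters and for dominated convergence.\<close>

lemma surv_eq_lborel:
  assumes "continuous_on UNIV f"
  shows "surv f s t = exp (- (\<integral>v. indicator {s..t} v *\<^sub>R f v \<partial>lborel))"
proof -
  have "set_integrable lborel {s..t} f"
    by (rule borel_integrable_atLeastAtMost') (rule continuous_on_subset[OF assms], simp)
  from set_borel_integral_eq_integral(2)[OF this] show ?thesis
    by (simp add: surv_def set_lebesgue_integral_def)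
qed

lemma surv_measurable:
  assumes c: "\<And>x. x \<in> space M \<Longrightarrow> continuous_on UNIV (f x)"
    and f: "(\<lambda>p. f (fst p) (snd p)) \<in> borel_measurable (M \<Otimes>\<^sub>M borel)"
    and g [measurable]: "g \<in> borel_measurable M" and h [measurable]: "h \<in> borel_measurable M"
  shows "(\<lambda>x. surv (f x) (g x) (h x)) \<in> borel_measurable M"
proof -
  have [measurable]: "(\<lambda>p. f (fst p) (snd p)) \<in> borel_measurable (M \<Otimes>\<^sub>M lborel)"
    using f by (simp cong: measurable_cong_sets)
  have [measurable]: "(\<lambda>(x, v). indicator {g x..h x} v *\<^sub>R f x v) \<in> borel_measurable (M \<Otimes>\<^sub>M lborel)"
  proof -
    have "(\<lambda>(x, v). indicator {g x..h x} v *\<^sub>R f x v)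
        = (\<lambda>p. (if g (fst p) \<le> snd p \<and> snd p \<le> h (fst p) then 1 else 0) * f (fst p) (snd p))"
      by (auto simp: fun_eq_iff indicator_def)
    then show ?thesis by simp
  qed
  have "(\<lambda>x. exp (- (\<integral>v. indicator {g x..h x} v *\<^sub>R f x v \<partial>lborel))) \<in> borel_measurable M"
    by measurable
  then show ?thesis
    by (subst measurable_cong[OF surv_eq_lborel[OF c]])
qed

lemma surv_tendsto:
  assumes c: "\<And>n. continuous_on UNIV (f n)" "continuous_on UNIV g"
    and b: "\<And>n u. \<bar>f n u\<bar> \<le> B" and lim: "\<And>u. (\<lambda>n. f n u) \<longlonglongrightarrow> g u"
  shows "(\<lambda>n. surv (f n) s t) \<longlonglongrightarrow> surv g s t"
proof -
  have [measurable]: "f n \<in> borel_measurable borel" "g \<in> borel_measurable borel" for n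
    using c by (auto intro: borel_measurable_continuous_onI)
  have "(\<lambda>n. \<integral>v. indicator {s..t} v *\<^sub>R f n v \<partial>lborel) \<longlonglongrightarrow> (\<integral>v. indicator {s..t} v *\<^sub>R g v \<partial>lborel)"
  proof (rule integral_dominated_convergence[where w="\<lambda>v. indicator {s..t} v * B"])
    show "integrable lborel (\<lambda>v. indicator {s..t} v * B)"
      by (intro integrable_mult_left integrable_real_indicator) (auto simp: emeasure_lborel_Icc_eq)
    show "AE v in lborel. (\<lambda>n. indicator {s..t} v *\<^sub>R f n v) \<longlonglongrightarrow> indicator {s..t} v *\<^sub>R g v"
      by (intro AE_I2 tendsto_intros lim)
    show "AE v in lborel. norm (indicator {s..t} v *\<^sub>R f n v) \<le> indicator {s..t} v * B" for n
      using b by (auto simp: indicator_def)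
  qed measurable
  then show ?thesis
    unfolding c[THEN surv_eq_lborel] by (intro tendsto_intros)
qed

locale bounded_rate =
  fixes f :: "real \<Rightarrow> real" and B :: real
  assumes cont: "continuous_on UNIV f" and nonneg: "0 \<le> f u" and le: "f u \<le> B"
begin

lemma integrable: "f integrable_on {s..t}"
  by (rule integrable_continuous_real) (rule continuous_on_subset[OF cont], simp)

lemma surv_le_1: "surv f s t \<le> 1"
  unfolding surv_def by (simp add: integral_nonneg integrable nonneg)

lemma surv_split: "s \<le> t \<Longrightarrow> t \<le> t' \<Longrightarrow> surv f s t' = surv f s t * surv f t t'"
  unfolding surv_def
  by (subst Henstock_Kurzweil_Integration.integral_combine[symmetric, of s t t'])
     (auto simp: integrable exp_add[symmetric])

lemma surv_antimono: "s \<le> t \<Longrightarrow> t \<le> t' \<Longrightarrow> surv f s t' \<le> surv f s t"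
  using surv_split[of s t t'] by (simp add: surv_le_1 mult_left_le)

lemma surv_ge: "t \<le> t' \<Longrightarrow> 1 - B * (t' - t) \<le> surv f t t'"
proof -
  assume "t \<le> t'"
  have "integral {t..t'} f \<le> integral {t..t'} (\<lambda>_. B)"
    by (intro integral_le integrable le) auto
  with \<open>t \<le> t'\<close> have "integral {t..t'} f \<le> B * (t' - t)"
    by (simp add: mult.commute)
  moreover have "1 - integral {t..t'} f \<le> surv f t t'"
    unfolding surv_def using exp_ge_add_one_self[of "- integral {t..t'} f"] by simp
  ultimately show ?thesis by simp
qed

text \<open>From \<open>exp (- x) \<ge> 1 - x\<close>. The factor \<open>surv f s t\<close> on the
  right is kept on purpose: over all positions of the last jump these factors combine to a
  probability, so the constant in \<open>no_jump_since_lipschitz_end\<close> remains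
  \<open>B\<close>.\<close>

lemma surv_lipschitz:
  assumes "s \<le> t" "t \<le> t'"
  shows "surv f s t \<le> surv f s t' + B * (t' - t) * surv f s t"
proof -
  have "surv f s t * (1 - B * (t' - t)) \<le> surv f s t * surv f t t'"
    by (intro mult_left_mono surv_ge assms) simp
  then show ?thesis using surv_split[OF assms] by (simp add: algebra_simps)
qed

lemma surv_measurable': "surv f s \<in> borel_measurable borel"
proof -
  have "f \<in> borel_measurable borel"
    using cont by (rule borel_measurable_continuous_onI)
  then have "(\<lambda>p. f (snd p)) \<in> borel_measurable (borel \<Otimes>\<^sub>M borel)"
    by simp
  then have "(\<lambda>x. surv f s x) \<in> borel_measurable borel"
    by (intro surv_measurable cont) auto
  then show ?thesis .
qed

text \<open>\<open>f u * surv f s u\<close> is the density of the first jump after \<open>s\<close>;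
  its primitive is \<open>- surv f s\<close>.\<close>

lemma nn_integral_density:
  assumes "s \<le> t"
  shows "(\<integral>\<^sup>+u. ennreal (f u * surv f s u) * indicator {s..t} u \<partial>lborel) = ennreal (1 - surv f s t)"
proof -
  have "((\<lambda>u. - surv f s u) has_real_derivative f u * surv f s u) (at u within {s..t})"
    if "u \<in> {s..t}" for u
  proof -
    have "((\<lambda>u. integral {s..u} f) has_real_derivative f u) (at u within {s..t})"
      by (rule integral_has_real_derivative[OF continuous_on_subset[OF cont] that]) simp
    then show ?thesis unfolding surv_def by (auto intro!: derivative_eq_intros)
  qed
  then have "((\<lambda>u. f u * surv f s u) has_integral (- surv f s t - (- surv f s s))) {s..t}"
    by (intro fundamental_theorem_of_calculus assms)
       (auto simp: has_real_derivative_iff_has_vector_derivative)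
  from nn_integral_has_integral_lebesgue'[OF _ this]
  show ?thesis by (simp add: nonneg)
qed

end

section \<open>The jump process of a single particle\<close>

lemma borel_measurable_indicator_Icc [measurable]:
  fixes a b f :: "'a \<Rightarrow> real"
  assumes [measurable]: "a \<in> borel_measurable M" "b \<in> borel_measurable M" "f \<in> borel_measurable M"
  shows "(\<lambda>x. indicator {a x..b x} (f x) :: ennreal) \<in> borel_measurable M"
proof -
  have "(\<lambda>x. indicator {a x..b x} (f x) :: ennreal) = (\<lambda>x. if a x \<le> f x \<and> f x \<le> b x then 1 else 0)"
    by (auto simp: indicator_def fun_eq_iff)
  then show ?thesis by simp
qed

text \<open>The parameter \<open>x\<close> will be the random particle \<open>(w, z)\<close>. With a
  one-point space \<open>M\<close> the lemma also yields measurability in time for fixed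
  rates.\<close>

lemma jump_density_measurable:
  assumes c: "\<And>x. x \<in> space M \<Longrightarrow> continuous_on UNIV (\<alpha> x)"
      "\<And>x s. x \<in> space M \<Longrightarrow> continuous_on UNIV (\<beta> x s)"
    and \<alpha> [measurable]: "(\<lambda>p. \<alpha> (fst p) (snd p)) \<in> borel_measurable (M \<Otimes>\<^sub>M borel)"
    and \<beta> [measurable]: "(\<lambda>p. \<beta> (fst p) (fst (snd p)) (snd (snd p)))
      \<in> borel_measurable (M \<Otimes>\<^sub>M (borel \<Otimes>\<^sub>M borel))"
  shows "(\<lambda>p. jump_density (\<alpha> (fst p)) (\<beta> (fst p)) k (snd p)) \<in> borel_measurable (M \<Otimes>\<^sub>M borel)"
proof (induction k)
  case 0
  have "(\<lambda>q. \<alpha> (fst (fst q)) (snd q)) \<in> borel_measurable ((M \<Otimes>\<^sub>M borel) \<Otimes>\<^sub>M borel)"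
    by (rule measurable_compose[OF _ \<alpha>, of "\<lambda>q. (fst (fst q), snd q)", simplified]) measurable
  then have [measurable]: "(\<lambda>p. surv (\<alpha> (fst p)) 0 (snd p)) \<in> borel_measurable (M \<Otimes>\<^sub>M borel)"
    by (intro surv_measurable) (auto simp: space_pair_measure c)
  show ?case by simp
next
  case (Suc k)
  note [measurable] = this
  have 1 [measurable]: "(\<lambda>q. \<beta> (fst (fst q)) (snd q) (snd (fst q)))
      \<in> borel_measurable ((M \<Otimes>\<^sub>M borel) \<Otimes>\<^sub>M lborel)"
    by (rule measurable_compose[OF _ \<beta>, of "\<lambda>q. (fst (fst q), snd q, snd (fst q))", simplified]) measurable
  have [measurable]: "(\<lambda>q. surv (\<beta> (fst (fst q)) (snd q)) (snd q) (snd (fst q)))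
      \<in> borel_measurable ((M \<Otimes>\<^sub>M borel) \<Otimes>\<^sub>M lborel)"
  proof (rule surv_measurable)
    show "(\<lambda>p. \<beta> (fst (fst (fst p))) (snd (fst p)) (snd p))
      \<in> borel_measurable (((M \<Otimes>\<^sub>M borel) \<Otimes>\<^sub>M lborel) \<Otimes>\<^sub>M borel)"
      by (rule measurable_compose[OF _ \<beta>, of "\<lambda>p. (fst (fst (fst p)), snd (fst p), snd p)", simplified])
         measurable
  qed (auto simp: space_pair_measure c)
  have [measurable]: "(\<lambda>q. jump_density (\<alpha> (fst (fst q))) (\<beta> (fst (fst q))) k (snd q))
      \<in> borel_measurable ((M \<Otimes>\<^sub>M borel) \<Otimes>\<^sub>M lborel)"
    by (rule measurable_compose[OF _ Suc, of "\<lambda>q. (fst (fst q), snd q)", simplified]) measurable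
  have [measurable]: "(\<lambda>q. indicator {0..snd (fst q)} (snd q :: real) :: ennreal)
      \<in> borel_measurable ((M \<Otimes>\<^sub>M borel) \<Otimes>\<^sub>M lborel)"
    by (rule borel_measurable_indicator_Icc[where a="\<lambda>_. 0"]) simp_all
  show ?case
    unfolding jump_density.simps
    by (rule lborel.borel_measurable_nn_integral) (simp add: split_beta')
qed

lemma last_jump_before_measurable:
  assumes c: "\<And>x. x \<in> space M \<Longrightarrow> continuous_on UNIV (\<alpha> x)"
      "\<And>x s. x \<in> space M \<Longrightarrow> continuous_on UNIV (\<beta> x s)"
    and \<alpha>: "(\<lambda>p. \<alpha> (fst p) (snd p)) \<in> borel_measurable (M \<Otimes>\<^sub>M borel)"
    and \<beta>: "(\<lambda>p. \<beta> (fst p) (fst (snd p)) (snd (snd p)))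
      \<in> borel_measurable (M \<Otimes>\<^sub>M (borel \<Otimes>\<^sub>M borel))"
  shows "(\<lambda>x. last_jump_before (\<alpha> x) (\<beta> x) k t0 t) \<in> borel_measurable M"
proof -
  have [measurable]: "(\<lambda>p. jump_density (\<alpha> (fst p)) (\<beta> (fst p)) k (snd p)) \<in> borel_measurable (M \<Otimes>\<^sub>M lborel)"
    using jump_density_measurable[of M \<alpha> \<beta>, OF c \<alpha> \<beta>] by (simp cong: measurable_cong_sets)
  have [measurable]: "(\<lambda>q. surv (\<beta> (fst q) (snd q)) (snd q) t) \<in> borel_measurable (M \<Otimes>\<^sub>M lborel)"
  proof (rule surv_measurable)
    show "(\<lambda>p. \<beta> (fst (fst p)) (snd (fst p)) (snd p)) \<in> borel_measurable ((M \<Otimes>\<^sub>M lborel) \<Otimes>\<^sub>M borel)"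
      by (rule measurable_compose[OF _ \<beta>, of "\<lambda>p. (fst (fst p), snd (fst p), snd p)", simplified])
         measurable
  qed (auto simp: space_pair_measure c)
  show ?thesis
    unfolding last_jump_before_def
    by (rule lborel.borel_measurable_nn_integral) (simp add: split_beta')
qed

lemma no_jump_since_measurable:
  assumes c: "\<And>x. x \<in> space M \<Longrightarrow> continuous_on UNIV (\<alpha> x)"
      "\<And>x s. x \<in> space M \<Longrightarrow> continuous_on UNIV (\<beta> x s)"
    and \<alpha>: "(\<lambda>p. \<alpha> (fst p) (snd p)) \<in> borel_measurable (M \<Otimes>\<^sub>M borel)"
    and \<beta>: "(\<lambda>p. \<beta> (fst p) (fst (snd p)) (snd (snd p)))
      \<in> borel_measurable (M \<Otimes>\<^sub>M (borel \<Otimes>\<^sub>M borel))"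
  shows "(\<lambda>x. no_jump_since (\<alpha> x) (\<beta> x) t0 t) \<in> borel_measurable M"
proof -
  have [measurable]: "(\<lambda>x. surv (\<alpha> x) 0 t) \<in> borel_measurable M"
    by (rule surv_measurable[OF c(1) \<alpha>]) auto
  have [measurable]: "(\<lambda>x. last_jump_before (\<alpha> x) (\<beta> x) k t0 t) \<in> borel_measurable M" for k
    by (rule last_jump_before_measurable[of M \<alpha> \<beta>, OF c \<alpha> \<beta>])
  show ?thesis unfolding no_jump_since_def by measurable
qed

locale renewal =
  fixes \<alpha> :: "real \<Rightarrow> real" and \<beta> :: "real \<Rightarrow> real \<Rightarrow> real" and B :: real
  assumes \<alpha>: "bounded_rate \<alpha> B" and \<beta>: "\<And>s. bounded_rate (\<beta> s) B"
    and \<beta>_measurable [measurable]: "(\<lambda>p. \<beta> (fst p) (snd p)) \<in> borel_measurable (borel \<Otimes>\<^sub>M borel)"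
begin

sublocale \<alpha>: bounded_rate \<alpha> B by (rule \<alpha>)
sublocale \<beta>: bounded_rate "\<beta> s" B for s by (rule \<beta>)

lemma B_nonneg: "0 \<le> B"
  using \<alpha>.nonneg \<alpha>.le order_trans by blast

lemma jump_density_borel [measurable]: "jump_density \<alpha> \<beta> k \<in> borel_measurable borel"
proof -
  have [measurable]: "\<alpha> \<in> borel_measurable borel"
    using \<alpha>.cont by (rule borel_measurable_continuous_onI)
  have "(\<lambda>p. jump_density \<alpha> \<beta> k (snd p)) \<in> borel_measurable (count_space (UNIV :: unit set) \<Otimes>\<^sub>M borel)"
    by (rule jump_density_measurable[of _ "\<lambda>_. \<alpha>" "\<lambda>_. \<beta>", OF \<alpha>.cont \<beta>.cont]) measurable
  from measurable_compose[OF _ this, of "\<lambda>u. ((), u)"] show ?thesis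
    by simp
qed

lemma surv_\<beta>_measurable [measurable]:
  "(\<lambda>p. surv (\<beta> (fst p)) (fst p) (snd p)) \<in> borel_measurable (borel \<Otimes>\<^sub>M borel)"
proof (rule surv_measurable[OF \<beta>.cont])
  show "(\<lambda>p. \<beta> (fst (fst p)) (snd p)) \<in> borel_measurable ((borel \<Otimes>\<^sub>M borel) \<Otimes>\<^sub>M borel)"
    by (rule measurable_compose[OF _ \<beta>_measurable, of "\<lambda>p. (fst (fst p), snd p)", simplified])
       measurable
qed auto

lemma jump_kernel_measurable [measurable]:
  assumes [measurable]: "f \<in> borel_measurable M" "g \<in> borel_measurable M"
  shows "(\<lambda>x. \<beta> (f x) (g x)) \<in> borel_measurable M" "(\<lambda>x. surv (\<beta> (f x)) (f x) (g x)) \<in> borel_measurable M"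
  using measurable_compose[OF _ \<beta>_measurable, of "\<lambda>x. (f x, g x)" M]
    measurable_compose[OF _ surv_\<beta>_measurable, of "\<lambda>x. (f x, g x)" M] by simp_all

lemma jump_density_0_le: "jump_density \<alpha> \<beta> 0 u \<le> ennreal (B * surv \<alpha> 0 u)"
  by (auto intro!: ennreal_leI mult_right_mono \<alpha>.le)

text \<open>The weight \<open>exp (2 * B * s)\<close> has twice the exponent of the rate bound, so
  integrating it against \<open>B\<close> gains the factor 1/2 (a Bielecki weight).\<close>

lemma nn_integral_exp_growth:
  assumes "0 \<le> u"
  shows "(\<integral>\<^sup>+s. ennreal (B * exp (2 * B * s)) * indicator {0..u} s \<partial>lborel) \<le> ennreal (exp (2 * B * u) / 2)"
proof -
  have "((\<lambda>s. B * exp (2 * B * s)) has_integral (exp (2 * B * u) / 2 - exp (2 * B * 0) / 2)) {0..u}"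
    by (intro fundamental_theorem_of_calculus assms)
       (auto simp: has_real_derivative_iff_has_vector_derivative[symmetric] intro!: derivative_eq_intros)
  from nn_integral_has_integral_lebesgue'[OF _ this]
  show ?thesis using B_nonneg by (auto intro!: ennreal_leI)
qed

text \<open>Every further jump contributes one factor 1/2 by \<open>nn_integral_exp_growth\<close>,
  which makes the bound summable over \<open>k\<close>. Being exponential in \<open>B\<close>, it
  serves for a single particle only.\<close>

lemma jump_density_bound:
  "0 \<le> u \<Longrightarrow> jump_density \<alpha> \<beta> k u \<le> ennreal (B * exp (2 * B * u) / 2 ^ k)"
proof (induction k arbitrary: u)
  case 0
  have "B * surv \<alpha> 0 u \<le> B * exp (2 * B * u)"
    using \<alpha>.surv_le_1[of 0 u] B_nonneg 0
    by (intro mult_left_mono) (auto intro: order_trans[of _ 1])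
  with jump_density_0_le[of u] show ?case
    by (auto intro: order_trans ennreal_leI simp del: jump_density.simps)
next
  case (Suc k)
  have "jump_density \<alpha> \<beta> (Suc k) u
      \<le> (\<integral>\<^sup>+s. ennreal (B / 2 ^ k) * (ennreal (B * exp (2 * B * s)) * indicator {0..u} s) \<partial>lborel)"
    unfolding jump_density.simps
  proof (intro nn_integral_mono)
    fix s
    show "indicator {0..u} s * (jump_density \<alpha> \<beta> k s * ennreal (\<beta> s u * surv (\<beta> s) s u))
        \<le> ennreal (B / 2 ^ k) * (ennreal (B * exp (2 * B * s)) * indicator {0..u} s)"
    proof (cases "s \<in> {0..u}")
      case True
      have "\<beta> s u * surv (\<beta> s) s u \<le> B * 1"
        by (intro mult_mono \<beta>.le \<beta>.surv_le_1 B_nonneg) auto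
      then have "jump_density \<alpha> \<beta> k s * ennreal (\<beta> s u * surv (\<beta> s) s u)
          \<le> ennreal (B * exp (2 * B * s) / 2 ^ k) * ennreal B"
        using True by (intro mult_mono Suc.IH) (auto intro: ennreal_leI)
      also have "\<dots> = ennreal (B / 2 ^ k) * ennreal (B * exp (2 * B * s))"
        using B_nonneg by (simp add: ennreal_mult[symmetric] ac_simps)
      finally show ?thesis using True by simp
    qed simp
  qed
  also have "\<dots> = ennreal (B / 2 ^ k) * (\<integral>\<^sup>+s. ennreal (B * exp (2 * B * s)) * indicator {0..u} s \<partial>lborel)"
    by (rule nn_integral_cmult) measurable
  also have "\<dots> \<le> ennreal (B / 2 ^ k) * ennreal (exp (2 * B * u) / 2)"
    by (intro mult_left_mono nn_integral_exp_growth Suc.prems) auto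
  also have "\<dots> = ennreal (B * exp (2 * B * u) / 2 ^ Suc k)"
    using B_nonneg by (simp add: ennreal_mult[symmetric])
  finally show ?case .
qed

lemma jump_mass_bound:
  assumes "0 \<le> t"
  shows "(\<integral>\<^sup>+u. indicator {0..t} u * jump_density \<alpha> \<beta> k u \<partial>lborel) \<le> ennreal (t * (B * exp (2 * B * t)) / 2 ^ k)"
proof -
  have "(\<integral>\<^sup>+u. indicator {0..t} u * jump_density \<alpha> \<beta> k u \<partial>lborel)
      \<le> (\<integral>\<^sup>+u. ennreal (B * exp (2 * B * t) / 2 ^ k) * indicator {0..t} u \<partial>lborel)"
  proof (intro nn_integral_mono)
    fix u
    have "jump_density \<alpha> \<beta> k u \<le> ennreal (B * exp (2 * B * t) / 2 ^ k)" if "u \<in> {0..t}"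
    proof -
      have "B * exp (2 * B * u) / 2 ^ k \<le> B * exp (2 * B * t) / 2 ^ k"
        using that B_nonneg by (intro divide_right_mono mult_left_mono) (auto intro: mult_left_mono)
      then show ?thesis using that jump_density_bound[of u k]
        by (auto intro: order_trans ennreal_leI)
    qed
    then show "indicator {0..t} u * jump_density \<alpha> \<beta> k u \<le> ennreal (B * exp (2 * B * t) / 2 ^ k) * indicator {0..t} u"
      by (auto simp: indicator_def)
  qed
  also have "\<dots> = ennreal (t * (B * exp (2 * B * t)) / 2 ^ k)"
    using assms B_nonneg
    by (subst nn_integral_cmult_indicator) (auto simp: ennreal_mult[symmetric] ac_simps)
  finally show ?thesis .
qed

text \<open>A particle that has jumped at least \<open>k + 1\<close> times by time \<open>t\<close> has either jumped once more or
  rested since jump \<open>k + 1\<close>; summing over \<open>k\<close> telescopes.\<close>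

lemma jump_mass_Suc:
  assumes "0 \<le> t"
  shows "(\<integral>\<^sup>+u. indicator {0..t} u * jump_density \<alpha> \<beta> (Suc k) u \<partial>lborel) + last_jump_before \<alpha> \<beta> k t t
    = (\<integral>\<^sup>+u. indicator {0..t} u * jump_density \<alpha> \<beta> k u \<partial>lborel)"
proof -
  have [measurable]: "(\<lambda>q. indicator {0..fst q} (snd q :: real) :: ennreal) \<in> borel_measurable (lborel \<Otimes>\<^sub>M lborel)"
    "(\<lambda>q. indicator {0..snd q} (fst q :: real) :: ennreal) \<in> borel_measurable (lborel \<Otimes>\<^sub>M lborel)"
    by (auto intro!: borel_measurable_indicator_Icc[where a="\<lambda>_. 0"])
  let ?b = "\<lambda>s u. ennreal (\<beta> s u * surv (\<beta> s) s u)"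
  have "(\<integral>\<^sup>+u. indicator {0..t} u * jump_density \<alpha> \<beta> (Suc k) u \<partial>lborel)
      = (\<integral>\<^sup>+u. \<integral>\<^sup>+s. indicator {0..t} u * (indicator {0..u} s * (jump_density \<alpha> \<beta> k s * ?b s u)) \<partial>lborel \<partial>lborel)"
    unfolding jump_density.simps by (subst nn_integral_cmult) auto
  \<comment> \<open>After the exchange the inner integral runs over the next jump time
    \<open>u\<close> in \<open>{s..t}\<close>, where \<open>nn_integral_density\<close> evaluates
    it.\<close>
  also have "\<dots> = (\<integral>\<^sup>+s. \<integral>\<^sup>+u. indicator {0..t} u * (indicator {0..u} s * (jump_density \<alpha> \<beta> k s * ?b s u)) \<partial>lborel \<partial>lborel)"
    by (rule lborel_pair.Fubini') (simp add: split_beta')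
  also have "\<dots> = (\<integral>\<^sup>+s. indicator {0..t} s * (jump_density \<alpha> \<beta> k s * ennreal (1 - surv (\<beta> s) s t)) \<partial>lborel)"
  proof (rule nn_integral_cong)
    fix s
    have "(\<integral>\<^sup>+u. indicator {0..t} u * (indicator {0..u} s * (jump_density \<alpha> \<beta> k s * ?b s u)) \<partial>lborel)
       = (\<integral>\<^sup>+u. indicator {0..t} s * jump_density \<alpha> \<beta> k s * (?b s u * indicator {s..t} u) \<partial>lborel)"
      by (intro nn_integral_cong) (auto simp: indicator_def)
    also have "\<dots> = indicator {0..t} s * jump_density \<alpha> \<beta> k s * (\<integral>\<^sup>+u. ?b s u * indicator {s..t} u \<partial>lborel)"
      by (rule nn_integral_cmult) measurable
    also have "\<dots> = indicator {0..t} s * (jump_density \<alpha> \<beta> k s * ennreal (1 - surv (\<beta> s) s t))"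
      by (cases "s \<in> {0..t}") (auto simp: \<beta>.nn_integral_density)
    finally show "(\<integral>\<^sup>+u. indicator {0..t} u * (indicator {0..u} s * (jump_density \<alpha> \<beta> k s * ?b s u)) \<partial>lborel)
      = indicator {0..t} s * (jump_density \<alpha> \<beta> k s * ennreal (1 - surv (\<beta> s) s t))" .
  qed
  finally have "(\<integral>\<^sup>+u. indicator {0..t} u * jump_density \<alpha> \<beta> (Suc k) u \<partial>lborel) + last_jump_before \<alpha> \<beta> k t t
    = (\<integral>\<^sup>+s. indicator {0..t} s * (jump_density \<alpha> \<beta> k s * ennreal (1 - surv (\<beta> s) s t))
        + indicator {0..t} s * (jump_density \<alpha> \<beta> k s * ennreal (surv (\<beta> s) s t)) \<partial>lborel)"
    unfolding last_jump_before_def by (subst nn_integral_add) auto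
  also have "\<dots> = (\<integral>\<^sup>+u. indicator {0..t} u * jump_density \<alpha> \<beta> k u \<partial>lborel)"
    by (intro nn_integral_cong)
       (simp add: distrib_left[symmetric] ennreal_plus[symmetric] \<beta>.surv_le_1 del: ennreal_plus)
  finally show ?thesis .
qed

text \<open>Non-explosion. The probability \<open>J k\<close> of at least \<open>k + 1\<close> jumps
  by time \<open>t\<close> tends to 0, so the telescoping sum loses no mass and equals
  \<open>J 0\<close>, the probability of at least one jump.\<close>

lemma suminf_last_jump_before_diag:
  assumes "0 \<le> t"
  shows "(\<Sum>k. last_jump_before \<alpha> \<beta> k t t) = ennreal (1 - surv \<alpha> 0 t)"
proof -
  define J where "J k = (\<integral>\<^sup>+u. indicator {0..t} u * jump_density \<alpha> \<beta> k u \<partial>lborel)" for k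
  \<comment> \<open>Subtraction in \<open>ennreal\<close> is truncated; the telescoping is done with
    real numbers.\<close>
  define j where "j k = enn2real (J k)" for k
  have bd: "J k \<le> ennreal (t * (B * exp (2 * B * t)) / 2 ^ k)" for k
    unfolding J_def by (rule jump_mass_bound[OF assms])
  then have fin: "J k < \<infinity>" for k
    by (rule le_less_trans) simp
  then have Jj: "J k = ennreal (j k)" for k
    by (simp add: j_def less_top)
  have "0 \<le> j k" for k by (simp add: j_def)
  have jle: "j k \<le> t * (B * exp (2 * B * t)) / 2 ^ k" for k
    using bd[of k] assms B_nonneg unfolding Jj by (subst (asm) ennreal_le_iff) auto
  have j0: "j \<longlonglongrightarrow> 0"
  proof (rule tendsto_sandwich[where f="\<lambda>_. 0"])
    show "(\<lambda>k. t * (B * exp (2 * B * t)) * (1 / 2) ^ k) \<longlonglongrightarrow> 0"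
      by (intro tendsto_mult_right_zero LIMSEQ_realpow_zero) auto
    show "\<forall>\<^sub>F k in sequentially. 0 \<le> j k"
      by (simp add: j_def)
    show "\<forall>\<^sub>F k in sequentially. j k \<le> t * (B * exp (2 * B * t)) * (1 / 2) ^ k"
      using jle by (simp add: power_divide)
  qed (auto simp: j_def)
  have step: "J (Suc k) + last_jump_before \<alpha> \<beta> k t t = J k" for k
    unfolding J_def by (rule jump_mass_Suc[OF assms])
  have L: "last_jump_before \<alpha> \<beta> k t t = ennreal (j k - j (Suc k))" for k
  proof -
    have "last_jump_before \<alpha> \<beta> k t t = J k - J (Suc k)"
      unfolding step[of k, symmetric] using fin[of "Suc k"] by simp
    then show ?thesis unfolding Jj by (simp add: ennreal_minus \<open>\<And>k. 0 \<le> j k\<close>)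
  qed
  have mono: "j (Suc k) \<le> j k" for k
  proof -
    have "ennreal (j (Suc k)) \<le> ennreal (j k)"
      using step[of k] unfolding Jj by (metis le_iff_add)
    then show ?thesis by (simp add: \<open>\<And>k. 0 \<le> j k\<close>)
  qed
  have "(\<lambda>k. j k - j (Suc k)) sums (j 0 - 0)"
    by (rule telescope_sums'[OF j0])
  then have "(\<Sum>k. last_jump_before \<alpha> \<beta> k t t) = ennreal (j 0)"
    unfolding L using mono by (subst suminf_ennreal2) (auto simp: sums_iff)
  also have "\<dots> = J 0" by (simp add: Jj)
  also have "\<dots> = ennreal (1 - surv \<alpha> 0 t)"
    using \<alpha>.nn_integral_density[OF assms] by (simp add: J_def mult.commute)
  finally show ?thesis .
qed

text \<open>The left side is the total jump intensity at \<open>u\<close>. A jump at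
  \<open>u\<close> needs a current state (no jump yet, or some last jump before \<open>u\<close>)
  and then has rate at most \<open>B\<close>; by non-explosion the probabilities of the states add
  up to 1. This replaces the exponential bound wherever constants must be linear in
  \<open>B\<close>.\<close>

lemma suminf_jump_density_le:
  assumes "0 \<le> u"
  shows "(\<Sum>k. jump_density \<alpha> \<beta> k u) \<le> ennreal B"
proof -
  have *: "jump_density \<alpha> \<beta> (Suc k) u \<le> ennreal B * last_jump_before \<alpha> \<beta> k u u" for k
  proof -
    have "jump_density \<alpha> \<beta> (Suc k) u
      \<le> (\<integral>\<^sup>+s. ennreal B * (indicator {0..u} s * (jump_density \<alpha> \<beta> k s * ennreal (surv (\<beta> s) s u))) \<partial>lborel)"
      unfolding jump_density.simps
    proof (intro nn_integral_mono)
      fix s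
      have "ennreal (\<beta> s u * surv (\<beta> s) s u) \<le> ennreal B * ennreal (surv (\<beta> s) s u)"
        using B_nonneg \<beta>.le by (auto simp: ennreal_mult[symmetric] intro!: ennreal_leI mult_right_mono)
      then show "indicator {0..u} s * (jump_density \<alpha> \<beta> k s * ennreal (\<beta> s u * surv (\<beta> s) s u))
         \<le> ennreal B * (indicator {0..u} s * (jump_density \<alpha> \<beta> k s * ennreal (surv (\<beta> s) s u)))"
        by (auto simp: indicator_def mult.left_commute[of "ennreal B"] intro!: mult_left_mono)
    qed
    also have "\<dots> = ennreal B * last_jump_before \<alpha> \<beta> k u u"
      unfolding last_jump_before_def by (rule nn_integral_cmult) measurable
    finally show ?thesis .
  qed
  have "(\<Sum>k. jump_density \<alpha> \<beta> k u) = (\<Sum>k. jump_density \<alpha> \<beta> (Suc k) u) + jump_density \<alpha> \<beta> 0 u"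
    by (rule suminf_offset[where i=1, simplified, THEN trans]) (auto simp: add.commute)
  also have "\<dots> \<le> (\<Sum>k. ennreal B * last_jump_before \<alpha> \<beta> k u u) + ennreal (B * surv \<alpha> 0 u)"
    by (intro add_mono suminf_le * jump_density_0_le) auto
  also have "\<dots> = ennreal B * ennreal (1 - surv \<alpha> 0 u) + ennreal (B * surv \<alpha> 0 u)"
    by (simp add: ennreal_suminf_cmult suminf_last_jump_before_diag[OF assms])
  also have "\<dots> = ennreal B"
    using B_nonneg \<alpha>.surv_le_1[of 0 u] mult_left_mono[OF \<alpha>.surv_le_1[of 0 u] B_nonneg]
    by (simp add: ennreal_mult[symmetric] ennreal_plus[symmetric] algebra_simps del: ennreal_plus)
  finally show ?thesis .
qed

end

section \<open>Monotonicity and Lipschitz bounds in both time arguments\<close>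

context renewal
begin

lemma last_jump_before_mono:
  assumes "t0 \<le> t0'"
  shows "last_jump_before \<alpha> \<beta> k t0 t \<le> last_jump_before \<alpha> \<beta> k t0' t"
  unfolding last_jump_before_def using assms
  by (intro nn_integral_mono mult_right_mono) (auto simp: indicator_def)

text \<open>Raising \<open>t0\<close> to \<open>t0'\<close> only adds the event that the last jump
  falls in between; it is bounded by the expected number of jumps there, the integral of the total
  intensity.\<close>

lemma suminf_last_jump_before_lipschitz:
  assumes "0 \<le> t0" "t0 \<le> t0'" "t0' \<le> t"
  shows "(\<Sum>k. last_jump_before \<alpha> \<beta> k t0' t)
    \<le> (\<Sum>k. last_jump_before \<alpha> \<beta> k t0 t) + ennreal (B * (t0' - t0))"
proof -
  have le: "last_jump_before \<alpha> \<beta> k t0' t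
      \<le> last_jump_before \<alpha> \<beta> k t0 t + (\<integral>\<^sup>+u. indicator {t0..t0'} u * jump_density \<alpha> \<beta> k u \<partial>lborel)" for k
  proof -
    have "last_jump_before \<alpha> \<beta> k t0' t
      \<le> (\<integral>\<^sup>+u. indicator {0..t0} u * (jump_density \<alpha> \<beta> k u * ennreal (surv (\<beta> u) u t))
           + indicator {t0..t0'} u * jump_density \<alpha> \<beta> k u \<partial>lborel)"
      unfolding last_jump_before_def
    proof (intro nn_integral_mono)
      fix u
      have "jump_density \<alpha> \<beta> k u * ennreal (surv (\<beta> u) u t) \<le> jump_density \<alpha> \<beta> k u * 1"
        by (intro mult_left_mono) (auto simp: \<beta>.surv_le_1)
      then show "indicator {0..t0'} u * (jump_density \<alpha> \<beta> k u * ennreal (surv (\<beta> u) u t))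
        \<le> indicator {0..t0} u * (jump_density \<alpha> \<beta> k u * ennreal (surv (\<beta> u) u t))
           + indicator {t0..t0'} u * jump_density \<alpha> \<beta> k u"
        using assms by (auto simp: indicator_def)
    qed
    also have "\<dots> = last_jump_before \<alpha> \<beta> k t0 t + (\<integral>\<^sup>+u. indicator {t0..t0'} u * jump_density \<alpha> \<beta> k u \<partial>lborel)"
      unfolding last_jump_before_def by (rule nn_integral_add) auto
    finally show ?thesis .
  qed
  have "(\<Sum>k. last_jump_before \<alpha> \<beta> k t0' t) \<le> (\<Sum>k. last_jump_before \<alpha> \<beta> k t0 t
      + (\<integral>\<^sup>+u. indicator {t0..t0'} u * jump_density \<alpha> \<beta> k u \<partial>lborel))"
    by (intro suminf_le le) auto
  also have "\<dots> = (\<Sum>k. last_jump_before \<alpha> \<beta> k t0 t)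
      + (\<Sum>k. \<integral>\<^sup>+u. indicator {t0..t0'} u * jump_density \<alpha> \<beta> k u \<partial>lborel)"
    by (rule suminf_add[symmetric]) auto
  also have "(\<Sum>k. \<integral>\<^sup>+u. indicator {t0..t0'} u * jump_density \<alpha> \<beta> k u \<partial>lborel)
      = (\<integral>\<^sup>+u. indicator {t0..t0'} u * (\<Sum>k. jump_density \<alpha> \<beta> k u) \<partial>lborel)"
    by (subst nn_integral_suminf[symmetric]) (auto simp: ennreal_suminf_cmult)
  also have "\<dots> \<le> (\<integral>\<^sup>+u. ennreal B * indicator {t0..t0'} u \<partial>lborel)"
    using suminf_jump_density_le assms by (intro nn_integral_mono) (auto simp: indicator_def)
  also have "\<dots> = ennreal (B * (t0' - t0))"
    using assms B_nonneg by (subst nn_integral_cmult_indicator) (auto simp: ennreal_mult)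
  finally show ?thesis by (simp add: add_left_mono)
qed

lemma last_jump_before_antimono:
  assumes "t0 \<le> t" "t \<le> t'"
  shows "last_jump_before \<alpha> \<beta> k t0 t' \<le> last_jump_before \<alpha> \<beta> k t0 t"
  unfolding last_jump_before_def using assms
  by (intro nn_integral_mono) (auto simp: indicator_def intro!: mult_left_mono \<beta>.surv_antimono)

lemma last_jump_before_lipschitz:
  assumes "t0 \<le> t" "t \<le> t'"
  shows "last_jump_before \<alpha> \<beta> k t0 t
    \<le> last_jump_before \<alpha> \<beta> k t0 t' + ennreal (B * (t' - t)) * last_jump_before \<alpha> \<beta> k t0 t"
proof -
  have "last_jump_before \<alpha> \<beta> k t0 t
     \<le> (\<integral>\<^sup>+u. indicator {0..t0} u * (jump_density \<alpha> \<beta> k u * ennreal (surv (\<beta> u) u t'))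
        + ennreal (B * (t' - t)) * (indicator {0..t0} u * (jump_density \<alpha> \<beta> k u * ennreal (surv (\<beta> u) u t))) \<partial>lborel)"
    unfolding last_jump_before_def
  proof (intro nn_integral_mono)
    fix u
    have "jump_density \<alpha> \<beta> k u * ennreal (surv (\<beta> u) u t)
        \<le> jump_density \<alpha> \<beta> k u * (ennreal (surv (\<beta> u) u t') + ennreal (B * (t' - t)) * ennreal (surv (\<beta> u) u t))"
      if "u \<in> {0..t0}"
      using that assms B_nonneg \<beta>.surv_lipschitz[of u t t' u]
      by (intro mult_left_mono) (auto simp: ennreal_mult[symmetric] ennreal_plus[symmetric] simp del: ennreal_plus)
    then show "indicator {0..t0} u * (jump_density \<alpha> \<beta> k u * ennreal (surv (\<beta> u) u t))
       \<le> indicator {0..t0} u * (jump_density \<alpha> \<beta> k u * ennreal (surv (\<beta> u) u t'))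
        + ennreal (B * (t' - t)) * (indicator {0..t0} u * (jump_density \<alpha> \<beta> k u * ennreal (surv (\<beta> u) u t)))"
      by (auto simp: indicator_def distrib_left ac_simps)
  qed
  also have "\<dots> = last_jump_before \<alpha> \<beta> k t0 t' + ennreal (B * (t' - t)) * last_jump_before \<alpha> \<beta> k t0 t"
    unfolding last_jump_before_def by (subst nn_integral_add) (auto simp: nn_integral_cmult)
  finally show ?thesis .
qed

text \<open>The series is dominated by its value at \<open>t0 = t\<close>. Written as
  \<open>ennreal\<close> of a real number, it lets comparisons of series be read as inequalities
  between reals.\<close>

lemma suminf_last_jump_before_finite:
  assumes "0 \<le> t0" "t0 \<le> t"
  shows "(\<Sum>k. last_jump_before \<alpha> \<beta> k t0 t) = ennreal (no_jump_since \<alpha> \<beta> t0 t - surv \<alpha> 0 t)"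
proof -
  have "(\<Sum>k. last_jump_before \<alpha> \<beta> k t0 t) \<le> (\<Sum>k. last_jump_before \<alpha> \<beta> k t t)"
    by (intro suminf_le last_jump_before_mono assms) auto
  also have "\<dots> < \<infinity>"
    using assms by (simp add: suminf_last_jump_before_diag)
  finally show ?thesis
    by (simp add: no_jump_since_def less_top)
qed

lemma no_jump_since_ge: "surv \<alpha> 0 t \<le> no_jump_since \<alpha> \<beta> t0 t"
  by (simp add: no_jump_since_def)

lemma no_jump_since_nonneg: "0 \<le> no_jump_since \<alpha> \<beta> t0 t"
  by (simp add: no_jump_since_def)

text \<open>The interval \<open>(t, t]\<close> is empty, but the identity rests on non-explosion. It
  becomes the condition that \<open>\<theta> ((y0, t0), t0) = y0\<close>.\<close>

lemma no_jump_since_diag: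
  assumes "0 \<le> t"
  shows "no_jump_since \<alpha> \<beta> t t = 1"
  using \<alpha>.surv_le_1[of 0 t]
  by (simp add: no_jump_since_def suminf_last_jump_before_diag[OF assms])

lemma no_jump_since_mono:
  assumes "0 \<le> t0" "t0 \<le> t0'" "t0' \<le> t"
  shows "no_jump_since \<alpha> \<beta> t0 t \<le> no_jump_since \<alpha> \<beta> t0' t"
proof -
  have "(\<Sum>k. last_jump_before \<alpha> \<beta> k t0 t) \<le> (\<Sum>k. last_jump_before \<alpha> \<beta> k t0' t)"
    by (intro suminf_le last_jump_before_mono assms) auto
  then show ?thesis
    using assms no_jump_since_ge by (simp add: suminf_last_jump_before_finite ennreal_le_iff)
qed

lemma no_jump_since_le_1:
  assumes "0 \<le> t0" "t0 \<le> t"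
  shows "no_jump_since \<alpha> \<beta> t0 t \<le> 1"
  using no_jump_since_mono[of t0 t t] no_jump_since_diag[of t] assms by simp

lemma no_jump_since_lipschitz_start:
  assumes "0 \<le> t0" "t0 \<le> t0'" "t0' \<le> t"
  shows "no_jump_since \<alpha> \<beta> t0' t \<le> no_jump_since \<alpha> \<beta> t0 t + B * (t0' - t0)"
proof -
  have "ennreal (no_jump_since \<alpha> \<beta> t0' t - surv \<alpha> 0 t)
      \<le> ennreal (no_jump_since \<alpha> \<beta> t0 t - surv \<alpha> 0 t) + ennreal (B * (t0' - t0))"
    using suminf_last_jump_before_lipschitz[OF assms] assms by (simp add: suminf_last_jump_before_finite)
  then have "no_jump_since \<alpha> \<beta> t0' t - surv \<alpha> 0 t \<le> no_jump_since \<alpha> \<beta> t0 t - surv \<alpha> 0 t + B * (t0' - t0)"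
    using assms B_nonneg no_jump_since_ge[of t t0]
    by (simp add: ennreal_plus[symmetric] ennreal_le_iff del: ennreal_plus)
  then show ?thesis by simp
qed

lemma no_jump_since_antimono:
  assumes "0 \<le> t0" "t0 \<le> t" "t \<le> t'"
  shows "no_jump_since \<alpha> \<beta> t0 t' \<le> no_jump_since \<alpha> \<beta> t0 t"
proof -
  have "(\<Sum>k. last_jump_before \<alpha> \<beta> k t0 t') \<le> (\<Sum>k. last_jump_before \<alpha> \<beta> k t0 t)"
    by (intro suminf_le last_jump_before_antimono assms) auto
  then have "no_jump_since \<alpha> \<beta> t0 t' - surv \<alpha> 0 t' \<le> no_jump_since \<alpha> \<beta> t0 t - surv \<alpha> 0 t"
    using assms no_jump_since_ge by (simp add: suminf_last_jump_before_finite ennreal_le_iff)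
  then show ?thesis using \<alpha>.surv_antimono[of 0 t t'] assms by simp
qed

lemma no_jump_since_lipschitz_end:
  assumes "0 \<le> t0" "t0 \<le> t" "t \<le> t'"
  shows "no_jump_since \<alpha> \<beta> t0 t \<le> no_jump_since \<alpha> \<beta> t0 t' + B * (t' - t)"
proof -
  let ?r = "\<lambda>t. no_jump_since \<alpha> \<beta> t0 t - surv \<alpha> 0 t"
  have "(\<Sum>k. last_jump_before \<alpha> \<beta> k t0 t) \<le> (\<Sum>k. last_jump_before \<alpha> \<beta> k t0 t'
      + ennreal (B * (t' - t)) * last_jump_before \<alpha> \<beta> k t0 t)"
    by (intro suminf_le last_jump_before_lipschitz assms) auto
  also have "\<dots> = (\<Sum>k. last_jump_before \<alpha> \<beta> k t0 t') + ennreal (B * (t' - t)) * (\<Sum>k. last_jump_before \<alpha> \<beta> k t0 t)"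
    by (subst suminf_add[symmetric]) (auto simp: ennreal_suminf_cmult)
  finally have "ennreal (?r t) \<le> ennreal (?r t' + B * (t' - t) * ?r t)"
    using assms no_jump_since_ge B_nonneg
    by (simp add: suminf_last_jump_before_finite ennreal_plus ennreal_mult)
  then have "?r t \<le> ?r t' + B * (t' - t) * ?r t"
    using assms no_jump_since_ge B_nonneg by (subst (asm) ennreal_le_iff) auto
  moreover have "surv \<alpha> 0 t \<le> surv \<alpha> 0 t' + B * (t' - t) * surv \<alpha> 0 t"
    using assms by (intro \<alpha>.surv_lipschitz) auto
  ultimately have "no_jump_since \<alpha> \<beta> t0 t \<le> no_jump_since \<alpha> \<beta> t0 t' + B * (t' - t) * no_jump_since \<alpha> \<beta> t0 t"
    by (simp add: algebra_simps)
  moreover have "B * (t' - t) * no_jump_since \<alpha> \<beta> t0 t \<le> B * (t' - t) * 1"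
    using assms B_nonneg by (intro mult_left_mono no_jump_since_le_1) auto
  ultimately show ?thesis by simp
qed

end

text \<open>Pointwise convergence of the rates under a common bound is enough, so no modulus of
  continuity of \<open>w\<close> enters. Both the recursion step and the last-jump term integrate
  the density of jump \<open>k + 1\<close> against a bounded kernel; \<open>dct\<close> treats them
  together.\<close>

lemma renewal_tendsto:
  assumes n: "\<And>n. renewal (\<alpha> n) (\<beta> n) B" and r: "renewal \<alpha>' \<beta>' B"
    and lim: "\<And>u. (\<lambda>n. \<alpha> n u) \<longlonglongrightarrow> \<alpha>' u" "\<And>s u. (\<lambda>n. \<beta> n s u) \<longlonglongrightarrow> \<beta>' s u"
  shows jump_density_tendsto: "\<And>u. (\<lambda>n. jump_density (\<alpha> n) (\<beta> n) k u) \<longlonglongrightarrow> jump_density \<alpha>' \<beta>' k u"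
    and last_jump_before_tendsto: "\<And>t0 t. (\<lambda>n. last_jump_before (\<alpha> n) (\<beta> n) k t0 t) \<longlonglongrightarrow> last_jump_before \<alpha>' \<beta>' k t0 t"
proof -
  interpret n: renewal "\<alpha> n" "\<beta> n" B for n by (rule n)
  interpret r: renewal \<alpha>' \<beta>' B by (rule r)
  note [measurable] = n.jump_density_borel r.jump_density_borel n.jump_kernel_measurable r.jump_kernel_measurable
  have surv_\<alpha>: "(\<lambda>n. surv (\<alpha> n) s u) \<longlonglongrightarrow> surv \<alpha>' s u" for s u
    by (rule surv_tendsto[where B=B]) (use n.\<alpha>.cont r.\<alpha>.cont n.\<alpha>.nonneg n.\<alpha>.le lim in auto)
  have surv_\<beta>: "(\<lambda>n. surv (\<beta> n s) s u) \<longlonglongrightarrow> surv (\<beta>' s) s u" for s u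
    by (rule surv_tendsto[where B=B]) (use n.\<beta>.cont r.\<beta>.cont n.\<beta>.nonneg n.\<beta>.le lim in auto)
  text \<open>The exponential bound on the densities dominates both integrals.\<close>
  have dct: "(\<lambda>n. \<integral>\<^sup>+s. indicator {0..c} s * (jump_density (\<alpha> n) (\<beta> n) k s * ennreal (g n s)) \<partial>lborel)
      \<longlonglongrightarrow> (\<integral>\<^sup>+s. indicator {0..c} s * (jump_density \<alpha>' \<beta>' k s * ennreal (h s)) \<partial>lborel)"
    if IH: "\<And>u. (\<lambda>n. jump_density (\<alpha> n) (\<beta> n) k u) \<longlonglongrightarrow> jump_density \<alpha>' \<beta>' k u"
      and [measurable]: "\<And>n. g n \<in> borel_measurable borel" "h \<in> borel_measurable borel"
      and g: "\<And>s. (\<lambda>n. g n s) \<longlonglongrightarrow> h s" and bd: "\<And>n s. g n s \<le> C"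
    for k c g h C
  proof (rule nn_integral_dominated_convergence
      [where w="\<lambda>s. ennreal (B * exp (2 * B * c) / 2 ^ k) * ennreal C * indicator {0..c} s"])
    show "AE s in lborel. indicator {0..c} s * (jump_density (\<alpha> n) (\<beta> n) k s * ennreal (g n s))
        \<le> ennreal (B * exp (2 * B * c) / 2 ^ k) * ennreal C * indicator {0..c} s" for n
    proof (intro AE_I2)
      fix s
      have "jump_density (\<alpha> n) (\<beta> n) k s * ennreal (g n s)
          \<le> ennreal (B * exp (2 * B * c) / 2 ^ k) * ennreal C" if "s \<in> {0..c}"
      proof (rule mult_mono)
        have "B * exp (2 * B * s) / 2 ^ k \<le> B * exp (2 * B * c) / 2 ^ k"
          using that r.B_nonneg by (intro divide_right_mono mult_left_mono) (auto intro: mult_left_mono)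
        then show "jump_density (\<alpha> n) (\<beta> n) k s \<le> ennreal (B * exp (2 * B * c) / 2 ^ k)"
          using that n.jump_density_bound[of s n k] by (auto intro: order_trans ennreal_leI)
      qed (auto intro!: ennreal_leI bd)
      then show "indicator {0..c} s * (jump_density (\<alpha> n) (\<beta> n) k s * ennreal (g n s))
        \<le> ennreal (B * exp (2 * B * c) / 2 ^ k) * ennreal C * indicator {0..c} s"
        by (auto simp: indicator_def)
    qed
    show "(\<integral>\<^sup>+s. ennreal (B * exp (2 * B * c) / 2 ^ k) * ennreal C * indicator {0..c} s \<partial>lborel) < \<infinity>"
      by (subst nn_integral_cmult_indicator)
         (auto simp: emeasure_lborel_Icc_eq ennreal_mult_less_top)
    show "AE s in lborel. (\<lambda>n. indicator {0..c} s * (jump_density (\<alpha> n) (\<beta> n) k s * ennreal (g n s)))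
        \<longlonglongrightarrow> indicator {0..c} s * (jump_density \<alpha>' \<beta>' k s * ennreal (h s))"
    proof (intro AE_I2)
      fix s
      show "(\<lambda>n. indicator {0..c} s * (jump_density (\<alpha> n) (\<beta> n) k s * ennreal (g n s)))
        \<longlonglongrightarrow> indicator {0..c} s * (jump_density \<alpha>' \<beta>' k s * ennreal (h s))"
      proof (cases "s \<in> {0..c}")
        case True
        \<comment> \<open>Multiplication in \<open>ennreal\<close> is not continuous at zero times
          infinity, hence the limit factors have to be finite.\<close>
        then have "jump_density \<alpha>' \<beta>' k s < \<infinity>"
          using r.jump_density_bound[of s k] by (auto intro: le_less_trans)
        then have "(\<lambda>n. jump_density (\<alpha> n) (\<beta> n) k s * ennreal (g n s))
            \<longlonglongrightarrow> jump_density \<alpha>' \<beta>' k s * ennreal (h s)"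
          by (intro tendsto_mult_ennreal IH tendsto_ennrealI g) auto
        then show ?thesis using True by simp
      qed simp
    qed
  qed measurable
  show J: "(\<lambda>n. jump_density (\<alpha> n) (\<beta> n) k u) \<longlonglongrightarrow> jump_density \<alpha>' \<beta>' k u" for u k
  proof (induction k arbitrary: u)
    case 0
    show ?case by (auto intro!: tendsto_intros tendsto_ennrealI lim surv_\<alpha>)
  next
    case (Suc k)
    show ?case
      unfolding jump_density.simps
    proof (rule dct[OF Suc])
      show "\<beta> n s u * surv (\<beta> n s) s u \<le> B * 1" for n s
        by (intro mult_mono n.\<beta>.le n.\<beta>.surv_le_1 n.B_nonneg) auto
    qed (auto intro!: tendsto_intros lim surv_\<beta>)
  qed
  show "(\<lambda>n. last_jump_before (\<alpha> n) (\<beta> n) k t0 t) \<longlonglongrightarrow> last_jump_before \<alpha>' \<beta>' k t0 t" for t0 t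
    unfolding last_jump_before_def
    by (rule dct[OF J, where C=1]) (auto intro: surv_\<beta> n.\<beta>.surv_le_1)
qed

lemma no_jump_since_tendsto:
  assumes n: "\<And>n. renewal (\<alpha> n) (\<beta> n) B" and r: "renewal \<alpha>' \<beta>' B"
    and lim: "\<And>u. (\<lambda>n. \<alpha> n u) \<longlonglongrightarrow> \<alpha>' u" "\<And>s u. (\<lambda>n. \<beta> n s u) \<longlonglongrightarrow> \<beta>' s u"
    and t: "0 \<le> t0" "t0 \<le> t"
  shows "(\<lambda>n. no_jump_since (\<alpha> n) (\<beta> n) t0 t) \<longlonglongrightarrow> no_jump_since \<alpha>' \<beta>' t0 t"
proof -
  interpret n: renewal "\<alpha> n" "\<beta> n" B for n by (rule n)
  interpret r: renewal \<alpha>' \<beta>' B by (rule r)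
  define K where "K = t0 * (B * exp (2 * B * t0))"
  have "0 \<le> K" using t r.B_nonneg by (simp add: K_def)
  have bd: "last_jump_before (\<alpha> n) (\<beta> n) k t0 t \<le> ennreal (K * (1 / 2) ^ k)" for n k
  proof -
    have "last_jump_before (\<alpha> n) (\<beta> n) k t0 t \<le> (\<integral>\<^sup>+u. indicator {0..t0} u * jump_density (\<alpha> n) (\<beta> n) k u \<partial>lborel)"
      unfolding last_jump_before_def
    proof (intro nn_integral_mono)
      fix u
      have "jump_density (\<alpha> n) (\<beta> n) k u * ennreal (surv (\<beta> n u) u t) \<le> jump_density (\<alpha> n) (\<beta> n) k u * 1"
        by (intro mult_left_mono) (auto simp: n.\<beta>.surv_le_1)
      then show "indicator {0..t0} u * (jump_density (\<alpha> n) (\<beta> n) k u * ennreal (surv (\<beta> n u) u t))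
          \<le> indicator {0..t0} u * jump_density (\<alpha> n) (\<beta> n) k u"
        by (auto simp: indicator_def)
    qed
    also have "\<dots> \<le> ennreal (K * (1 / 2) ^ k)"
      using n.jump_mass_bound[OF t(1), of n k] by (simp add: K_def power_divide)
    finally show ?thesis .
  qed
  \<comment> \<open>The series is an integral over counting measure; the geometric bound depends on
    \<open>B\<close> and \<open>t0\<close> but not on \<open>n\<close>, so it dominates.\<close>
  have "(\<lambda>n. \<integral>\<^sup>+k. last_jump_before (\<alpha> n) (\<beta> n) k t0 t \<partial>count_space UNIV)
      \<longlonglongrightarrow> (\<integral>\<^sup>+k. last_jump_before \<alpha>' \<beta>' k t0 t \<partial>count_space UNIV)"
  proof (rule nn_integral_dominated_convergence[where w="\<lambda>k. ennreal (K * (1 / 2) ^ k)"])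
    have "summable (\<lambda>k. K * (1 / 2 :: real) ^ k)"
      by (intro summable_mult summable_geometric) auto
    then show "(\<integral>\<^sup>+k. ennreal (K * (1 / 2) ^ k) \<partial>count_space UNIV) < \<infinity>"
      using \<open>0 \<le> K\<close> by (simp add: nn_integral_count_space_nat suminf_ennreal2)
    show "AE k in count_space UNIV. (\<lambda>n. last_jump_before (\<alpha> n) (\<beta> n) k t0 t) \<longlonglongrightarrow> last_jump_before \<alpha>' \<beta>' k t0 t"
      by (intro AE_I2 last_jump_before_tendsto[OF n r lim])
  qed (auto simp: bd)
  then have *: "(\<lambda>n. \<Sum>k. last_jump_before (\<alpha> n) (\<beta> n) k t0 t) \<longlonglongrightarrow> (\<Sum>k. last_jump_before \<alpha>' \<beta>' k t0 t)"
    by (simp add: nn_integral_count_space_nat)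
  have "(\<lambda>n. surv (\<alpha> n) 0 t) \<longlonglongrightarrow> surv \<alpha>' 0 t"
    by (rule surv_tendsto[where B=B]) (use n.\<alpha>.cont r.\<alpha>.cont n.\<alpha>.nonneg n.\<alpha>.le lim in auto)
  moreover have "(\<lambda>n. enn2real (\<Sum>k. last_jump_before (\<alpha> n) (\<beta> n) k t0 t)) \<longlonglongrightarrow> enn2real (\<Sum>k. last_jump_before \<alpha>' \<beta>' k t0 t)"
    using * unfolding r.suminf_last_jump_before_finite[OF t]
    by (intro tendsto_enn2real) (auto simp: r.no_jump_since_ge)
  ultimately show ?thesis
    unfolding no_jump_since_def by (intro tendsto_add)
qed

section \<open>Integrals over ordered jump times\<close>

text \<open>Joint density of the first \<open>k\<close> jump times. The final survival factor of
  \<open>prodf\<close> is left out, so that the density for one more jump is obtained by multiplying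
  with one transition factor.\<close>

definition path_density :: "(real \<Rightarrow> real) \<Rightarrow> (real \<Rightarrow> real \<Rightarrow> real) \<Rightarrow> nat \<Rightarrow> (nat \<Rightarrow> real) \<Rightarrow> real" where
  "path_density \<alpha> \<beta> k u = \<alpha> (u 0) * surv \<alpha> 0 (u 0)
     * (\<Prod>i\<in>{1..<k}. \<beta> (u (i - 1)) (u i) * surv (\<beta> (u (i - 1))) (u (i - 1)) (u i))"

text \<open>Peeling off the largest time makes it the upper bound of the remaining simplex, as in
  the recursion of \<open>jump_density\<close>.\<close>

lemma osimplex_Suc_Suc:
  "u \<in> osimplex (Suc (Suc k)) t0 \<longleftrightarrow> u \<in> osimplex (Suc k) (u (Suc k)) \<and> u (Suc k) \<le> t0"
  by (auto simp: osimplex_def less_Suc_eq)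

lemma osimplex_bounds:
  assumes "u \<in> osimplex (Suc k) t0" "i \<le> k"
  shows "0 \<le> u i" "u i \<le> t0"
proof -
  have le: "u i \<le> u (Suc i)" if "i < k" for i
    using assms that by (auto simp: osimplex_def)
  have "u 0 \<le> u i" using assms(2)
  proof (induction i)
    case (Suc i)
    then show ?case using le[of i] by simp
  qed simp
  moreover have "u i \<le> u k" using assms(2)
  proof (induction rule: inc_induct)
    case (step n)
    then show ?case using le[of n] by simp
  qed simp
  ultimately show "0 \<le> u i" "u i \<le> t0"
    using assms(1) by (auto simp: osimplex_def)
qed

lemma osimplex_cong:
  assumes "\<And>i. i < k \<Longrightarrow> u i = v i" "0 < k"
  shows "u \<in> osimplex k t0 \<longleftrightarrow> v \<in> osimplex k t0"
  using assms by (auto simp: osimplex_def)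

lemma path_density_eqI:
  assumes "\<And>i. i < k \<Longrightarrow> u i = v i" "0 < k"
  shows "path_density \<alpha> \<beta> k u = path_density \<alpha> \<beta> k v"
proof -
  have "(\<Prod>i\<in>{1..<k}. \<beta> (u (i - 1)) (u i) * surv (\<beta> (u (i - 1))) (u (i - 1)) (u i))
      = (\<Prod>i\<in>{1..<k}. \<beta> (v (i - 1)) (v i) * surv (\<beta> (v (i - 1))) (v (i - 1)) (v i))"
  proof (rule prod.cong)
    fix i assume "i \<in> {1..<k}"
    then have "u (i - 1) = v (i - 1)" "u i = v i"
      by (auto intro!: assms(1))
    then show "\<beta> (u (i - 1)) (u i) * surv (\<beta> (u (i - 1))) (u (i - 1)) (u i)
      = \<beta> (v (i - 1)) (v i) * surv (\<beta> (v (i - 1))) (v (i - 1)) (v i)"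
      by (simp only:)
  qed simp
  then show ?thesis
    unfolding path_density_def using assms by (simp only:)
qed

lemma path_density_Suc:
  "path_density \<alpha> \<beta> (Suc (Suc k)) u
    = path_density \<alpha> \<beta> (Suc k) u * (\<beta> (u k) (u (Suc k)) * surv (\<beta> (u k)) (u k) (u (Suc k)))"
  by (simp add: path_density_def)

text \<open>On the simplex the rates are read only for \<open>0 \<le> s \<le> u \<le> t\<close>.
  This serves twice: to exchange the rates for total functions, and for causality.\<close>

lemma path_density_cong:
  assumes u: "u \<in> osimplex (Suc k) t0" "t0 \<le> t"
    and \<alpha>: "\<And>u. 0 \<le> u \<Longrightarrow> u \<le> t \<Longrightarrow> \<alpha> u = \<alpha>' u"
    and \<beta>: "\<And>s u. 0 \<le> s \<Longrightarrow> s \<le> u \<Longrightarrow> u \<le> t \<Longrightarrow> \<beta> s u = \<beta>' s u"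
  shows "path_density \<alpha> \<beta> (Suc k) u * surv (\<beta> (u k)) (u k) t
    = path_density \<alpha>' \<beta>' (Suc k) u * surv (\<beta>' (u k)) (u k) t"
proof -
  note b = osimplex_bounds[OF u(1)]
  have "surv \<alpha> 0 (u 0) = surv \<alpha>' 0 (u 0)"
    using b[of 0] u(2) by (intro surv_cong \<alpha>) auto
  moreover have "surv (\<beta> (u k)) (u k) t = surv (\<beta>' (u k)) (u k) t"
    using b[of k] by (intro surv_cong \<beta>) auto
  moreover have "\<alpha> (u 0) = \<alpha>' (u 0)"
    using b[of 0] u(2) by (intro \<alpha>) auto
  moreover have "\<beta> (u (i - 1)) (u i) * surv (\<beta> (u (i - 1))) (u (i - 1)) (u i)
      = \<beta>' (u (i - 1)) (u i) * surv (\<beta>' (u (i - 1))) (u (i - 1)) (u i)" if "i \<in> {1..<Suc k}" for i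
  proof -
    have le: "0 \<le> u (i - 1)" "u i \<le> t0" using b[of i] b[of "i - 1"] that by auto
    have "Suc (i - 1) < Suc k" "Suc (i - 1) = i" using that by auto
    then have "u (i - 1) \<le> u i" using u(1) unfolding osimplex_def by force
    with le u(2) show ?thesis by (intro arg_cong2[where f="(*)"] surv_cong \<beta>) auto
  qed
  ultimately show ?thesis unfolding path_density_def by simp
qed

context renewal
begin

lemma path_density_measurable [measurable]:
  "path_density \<alpha> \<beta> (Suc k) \<in> borel_measurable (\<Pi>\<^sub>M i\<in>{..<Suc k}. lborel)"
proof -
  have [measurable]: "\<alpha> \<in> borel_measurable borel" "surv \<alpha> 0 \<in> borel_measurable borel"
    using \<alpha>.cont \<alpha>.surv_measurable' by (auto intro: borel_measurable_continuous_onI)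
  have c [measurable]: "(\<lambda>u. u i) \<in> borel_measurable (\<Pi>\<^sub>M i\<in>{..<Suc k}. lborel)" if "i \<le> k" for i
    using measurable_component_singleton[of i "{..<Suc k}" "\<lambda>_. lborel"] that by simp
  show ?thesis
    unfolding path_density_def
    by (intro borel_measurable_times borel_measurable_prod jump_kernel_measurable c
          measurable_compose[OF c[of 0]]) auto
qed

lemma osimplex_measurable:
  "(\<lambda>u. indicator (osimplex (Suc k) t0) u :: ennreal) \<in> borel_measurable (\<Pi>\<^sub>M i\<in>{..<Suc k}. lborel)"
proof -
  have c: "(\<lambda>u. u i) \<in> borel_measurable (\<Pi>\<^sub>M i\<in>{..<Suc k}. lborel)" if "i \<le> k" for i
    using measurable_component_singleton[of i "{..<Suc k}" "\<lambda>_. lborel"] that by simp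
  have "(\<lambda>u. indicator (osimplex (Suc k) t0) u :: ennreal)
      = (\<lambda>u. if 0 \<le> u 0 \<and> (\<forall>i\<in>{..<k}. u i \<le> u (Suc i)) \<and> u k \<le> t0 then 1 else 0)"
    by (auto simp: indicator_def osimplex_def fun_eq_iff)
  moreover have "Measurable.pred (\<Pi>\<^sub>M i\<in>{..<Suc k}. lborel)
      (\<lambda>u. 0 \<le> u 0 \<and> (\<forall>i\<in>{..<k}. u i \<le> u (Suc i)) \<and> u k \<le> t0)"
  proof -
    have "Measurable.pred (\<Pi>\<^sub>M i\<in>{..<Suc k}. lborel) (\<lambda>u. f u \<le> g u)"
      if "f \<in> borel_measurable (\<Pi>\<^sub>M i\<in>{..<Suc k}. lborel)"
        "g \<in> borel_measurable (\<Pi>\<^sub>M i\<in>{..<Suc k}. lborel)" for f g :: "(nat \<Rightarrow> real) \<Rightarrow> real"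
      using borel_measurable_le[OF that] by (simp only: pred_def)
    then show ?thesis
      by (intro pred_intros_logic pred_intros_finite c) auto
  qed
  ultimately show ?thesis by simp
qed

lemma path_density_nonneg: "0 \<le> path_density \<alpha> \<beta> k u"
  unfolding path_density_def
  by (intro mult_nonneg_nonneg prod_nonneg \<alpha>.nonneg) (auto simp: \<beta>.nonneg)

text \<open>The test function \<open>g\<close> of the last jump time carries the induction: once the
  last coordinate \<open>y\<close> is split off, the hypothesis is used with the transition density
  to \<open>y\<close> as \<open>g\<close> and with \<open>y\<close> as the bound
  \<open>t0\<close>.\<close>

lemma nn_integral_path_density:
  assumes [measurable]: "g \<in> borel_measurable borel"
  shows "(\<integral>\<^sup>+u. indicator (osimplex (Suc k) t0) u * (ennreal (path_density \<alpha> \<beta> (Suc k) u) * g (u k))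
        \<partial>(\<Pi>\<^sub>M i\<in>{..<Suc k}. lborel))
    = (\<integral>\<^sup>+s. indicator {0..t0} s * (jump_density \<alpha> \<beta> k s * g s) \<partial>lborel)"
  using assms
proof (induction k arbitrary: t0 g)
  case 0
  note [measurable] = 0
  interpret product_sigma_finite "\<lambda>_. lborel :: real measure" ..
  have "(\<integral>\<^sup>+u. indicator (osimplex (Suc 0) t0) u * (ennreal (path_density \<alpha> \<beta> (Suc 0) u) * g (u 0))
        \<partial>(\<Pi>\<^sub>M i\<in>{..<Suc 0}. lborel))
    = (\<integral>\<^sup>+u. (\<lambda>s. indicator {0..t0} s * (jump_density \<alpha> \<beta> 0 s * g s)) (u 0) \<partial>(\<Pi>\<^sub>M i\<in>{0::nat}. lborel))"
    by (simp add: lessThan_Suc) (auto simp: path_density_def osimplex_def indicator_def intro!: nn_integral_cong)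
  also have "\<dots> = (\<integral>\<^sup>+s. indicator {0..t0} s * (jump_density \<alpha> \<beta> 0 s * g s) \<partial>lborel)"
    by (rule product_nn_integral_singleton) (use jump_density_borel[of 0] in measurable)
  finally show ?case .
next
  case (Suc k)
  note [measurable] = Suc.prems osimplex_measurable
  interpret product_sigma_finite "\<lambda>_. lborel :: real measure" ..
  let ?P = "\<lambda>k. \<Pi>\<^sub>M i\<in>{..<k}. (lborel :: real measure)"
  let ?F = "\<lambda>u. indicator (osimplex (Suc (Suc k)) t0) u * (ennreal (path_density \<alpha> \<beta> (Suc (Suc k)) u) * g (u (Suc k)))"
  have [measurable]: "(\<lambda>u. u (Suc k)) \<in> borel_measurable (?P (Suc (Suc k)))"
    using measurable_component_singleton[of "Suc k" "{..<Suc (Suc k)}" "\<lambda>_. lborel"] by simp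
  have "?F \<in> borel_measurable (?P (Suc (Suc k)))"
    by measurable
  then have "integral\<^sup>N (?P (Suc (Suc k))) ?F = (\<integral>\<^sup>+y. \<integral>\<^sup>+x. ?F (x(Suc k := y)) \<partial>(?P (Suc k)) \<partial>lborel)"
    unfolding lessThan_Suc[of "Suc k"] by (intro product_nn_integral_insert_rev) auto
  also have "\<dots> = (\<integral>\<^sup>+y. indicator {0..t0} y * (jump_density \<alpha> \<beta> (Suc k) y * g y) \<partial>lborel)"
  proof (rule nn_integral_cong)
    fix y
    let ?b = "\<lambda>s. ennreal (\<beta> s y * surv (\<beta> s) s y)"
    have 1: "(x(Suc k := y) \<in> osimplex (Suc (Suc k)) t0) = (x \<in> osimplex (Suc k) y \<and> y \<le> t0)" for x
      using osimplex_cong[of "Suc k" "x(Suc k := y)" x y] by (simp add: osimplex_Suc_Suc)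
    have 2: "path_density \<alpha> \<beta> (Suc (Suc k)) (x(Suc k := y))
        = path_density \<alpha> \<beta> (Suc k) x * (\<beta> (x k) y * surv (\<beta> (x k)) (x k) y)" for x
      using path_density_eqI[of "Suc k" "x(Suc k := y)" x] unfolding path_density_Suc by simp
    have "?F (x(Suc k := y)) = (indicator {..t0} y * g y)
        * (indicator (osimplex (Suc k) y) x * (ennreal (path_density \<alpha> \<beta> (Suc k) x) * ?b (x k)))" for x
      using path_density_nonneg[of "Suc k" x] \<beta>.nonneg[of "x k" y]
      unfolding 2 by (subst ennreal_mult) (auto simp: indicator_def 1 ac_simps)
    then have "(\<integral>\<^sup>+x. ?F (x(Suc k := y)) \<partial>(?P (Suc k)))
      = (\<integral>\<^sup>+x. (indicator {..t0} y * g y)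
        * (indicator (osimplex (Suc k) y) x * (ennreal (path_density \<alpha> \<beta> (Suc k) x) * ?b (x k))) \<partial>(?P (Suc k)))"
      by presburger
    also have "\<dots> = (indicator {..t0} y * g y) * (\<integral>\<^sup>+x.
        (indicator (osimplex (Suc k) y) x * (ennreal (path_density \<alpha> \<beta> (Suc k) x) * ?b (x k))) \<partial>(?P (Suc k)))"
    proof (rule nn_integral_cmult)
      have [measurable]: "(\<lambda>u. u k) \<in> borel_measurable (?P (Suc k))"
        using measurable_component_singleton[of k "{..<Suc k}" "\<lambda>_. lborel"] by simp
      show "(\<lambda>x. indicator (osimplex (Suc k) y) x * (ennreal (path_density \<alpha> \<beta> (Suc k) x) * ?b (x k)))
        \<in> borel_measurable (?P (Suc k))"
        by measurable
    qed
    also have "\<dots> = (indicator {..t0} y * g y) * jump_density \<alpha> \<beta> (Suc k) y"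
      by (subst Suc.IH) auto
    \<comment> \<open>For \<open>y < 0\<close> both sides vanish, because the interval
      \<open>{0..y}\<close> in \<open>jump_density\<close> is empty.\<close>
    also have "\<dots> = indicator {0..t0} y * (jump_density \<alpha> \<beta> (Suc k) y * g y)"
      by (cases "0 \<le> y") (auto simp: indicator_def ac_simps)
    finally show "(\<integral>\<^sup>+x. ?F (x(Suc k := y)) \<partial>(?P (Suc k)))
      = indicator {0..t0} y * (jump_density \<alpha> \<beta> (Suc k) y * g y)" .
  qed
  finally show ?case .
qed

end

section \<open>The random initial particle\<close>

lemma mem_Delta:
  "((y, s), t) \<in> Delta T \<longleftrightarrow> 0 \<le> y \<and> y \<le> 1 \<and> 0 \<le> s \<and> s \<le> t \<and> t \<le> T \<and> (y = 0 \<or> s = 0)"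
  by (auto simp: Delta_def Gam_t_def)

lemma compact_Delta: "compact (Delta T)"
proof -
  have "Delta T = (({0..1} \<times> {0..T}) \<times> {0..T})
      \<inter> {p. snd (fst p) \<le> snd p} \<inter> {p. fst (fst p) * snd (fst p) = 0}"
    by (auto simp: mem_Delta)
  moreover have "compact ((({0..1} \<times> {0..T}) \<times> {0..T}) :: ((real \<times> real) \<times> real) set)"
    by (intro compact_Times) auto
  moreover have "closed {p :: (real \<times> real) \<times> real. snd (fst p) \<le> snd p}"
    by (intro closed_Collect_le continuous_intros)
  moreover have "closed {p :: (real \<times> real) \<times> real. fst (fst p) * snd (fst p) = 0}"
    by (intro closed_Collect_eq continuous_intros)
  ultimately show ?thesis
    by (simp only: compact_Int_closed)
qed

definition clip :: "real \<Rightarrow> real \<Rightarrow> real \<Rightarrow> real" where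
  "clip a b x = max a (min b x)"

lemma clip_bounds: "a \<le> b \<Longrightarrow> a \<le> clip a b x" "a \<le> b \<Longrightarrow> clip a b x \<le> b"
  by (auto simp: clip_def)

lemma clip_id [simp]: "a \<le> x \<Longrightarrow> x \<le> b \<Longrightarrow> clip a b x = x"
  by (auto simp: clip_def)

lemma continuous_on_clip [continuous_intros]: "continuous_on S f \<Longrightarrow> continuous_on S (\<lambda>x. clip a b (f x))"
  unfolding clip_def by (intro continuous_intros)

lemma clip_measurable [measurable]: "clip a b \<in> borel_measurable borel"
  by (intro borel_measurable_continuous_onI continuous_intros)

locale particle_system =
  fixes T :: real
    and W :: "(real \<times> real \<Rightarrow> real) set"
    and lam :: "(real \<times> real \<Rightarrow> real) measure"
    and sig :: "(real \<times> real \<Rightarrow> real) \<Rightarrow> real \<Rightarrow> real"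
  assumes T_pos: "T > 0"
    and W_continuous: "\<And>w. w \<in> W \<Longrightarrow> continuous_on (rect T) w"
    and W_nonneg: "\<And>w p. w \<in> W \<Longrightarrow> p \<in> rect T \<Longrightarrow> 0 \<le> w p"
    and space_lam: "space lam = W"
    and sets_lam: "sets lam = sigma_sets W {U. supopen T W U}"
    and prob: "prob_space lam"
    and M_W: "integrable lam (supn T)"
    and sig_meas: "(\<lambda>(w, y). sig w y) \<in> borel_measurable (lam \<Otimes>\<^sub>M restrict_space lborel {0..1})"
    and sig_nonneg: "\<And>w y. w \<in> W \<Longrightarrow> y \<in> {0..1} \<Longrightarrow> sig w y \<ge> 0"
    and sig_int_w: "\<And>y. y \<in> {0..1} \<Longrightarrow> (\<integral>\<^sup>+ w. ennreal (sig w y) \<partial>lam) = 1"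
    and sig_int_z: "\<And>w. w \<in> W \<Longrightarrow> (\<integral>\<^sup>+ z\<in>{0..1}. ennreal (sig w z) \<partial>lborel) = 1"
begin

sublocale lam: prob_space lam by (rule prob)

sublocale pair_sigma_finite lam "lborel :: real measure" ..

lemma compact_rect: "compact (rect T)"
  unfolding rect_def by (intro compact_Times) auto

lemma abs_le_supn:
  assumes "continuous_on (rect T) f" "p \<in> rect T"
  shows "\<bar>f p\<bar> \<le> supn T f"
  unfolding supn_def
proof (rule cSUP_upper[OF assms(2)])
  have "compact ((\<lambda>p. \<bar>f p\<bar>) ` rect T)"
    by (intro compact_continuous_image continuous_intros assms compact_rect)
  then show "bdd_above ((\<lambda>p. \<bar>f p\<bar>) ` rect T)"
    by (intro bounded_imp_bdd_above compact_imp_bounded)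
qed

text \<open>The set \<open>{w. c < w p}\<close> is open in the supremum distance, with radius
  \<open>w p - c\<close> around \<open>w\<close>, and so belongs to the generating family.\<close>

lemma evaluation_measurable:
  assumes "p \<in> rect T"
  shows "(\<lambda>w. w p) \<in> borel_measurable lam"
  unfolding borel_measurable_iff_greater
proof
  fix c
  have "supopen T W {w \<in> W. c < w p}"
    unfolding supopen_def
  proof safe
    fix w assume "w \<in> W" "c < w p"
    have "v p > c" if "v \<in> W" "supn T (\<lambda>q. v q - w q) < w p - c" for v
    proof -
      have "\<bar>v p - w p\<bar> \<le> supn T (\<lambda>q. v q - w q)"
        using that \<open>w \<in> W\<close> by (intro abs_le_supn continuous_intros W_continuous assms)
      with that show ?thesis by linarith
    qed
    then show "\<exists>e>0. \<forall>v\<in>W. supn T (\<lambda>p. v p - w p) < e \<longrightarrow> v \<in> {w \<in> W. c < w p}"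
      using \<open>c < w p\<close> by (intro exI[of _ "w p - c"]) auto
  qed
  then show "{w \<in> space lam. c < w p} \<in> sets lam"
    unfolding sets_lam space_lam by (intro sigma_sets.Basic) simp
qed

text \<open>Clipping the arguments makes all rates total functions, so that the results on \<open>renewal\<close>
  carry no domain conditions.\<close>

definition rate_at :: "(real \<times> real \<Rightarrow> real) \<Rightarrow> real \<Rightarrow> real \<Rightarrow> real" where
  "rate_at w y t = w (clip 0 1 y, clip 0 T t)"

lemma clip_mem_rect: "(clip 0 1 y, clip 0 T t) \<in> rect T"
  using T_pos by (simp add: rect_def clip_bounds)

lemma rate_at_continuous:
  assumes "w \<in> W" "continuous_on S f" "continuous_on S g"
  shows "continuous_on S (\<lambda>x. rate_at w (f x) (g x))"
  unfolding rate_at_def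
  by (rule continuous_on_compose2[OF W_continuous[OF assms(1)]])
     (auto intro!: continuous_intros assms clip_mem_rect)

lemma rate_at_bounds: "w \<in> W \<Longrightarrow> 0 \<le> rate_at w y t" "w \<in> W \<Longrightarrow> rate_at w y t \<le> supn T w"
  unfolding rate_at_def using abs_le_supn[OF W_continuous clip_mem_rect, of w y t]
  by (auto intro: W_nonneg clip_mem_rect)

text \<open>Evaluation is measurable in \<open>w\<close> and continuous in \<open>(y, t)\<close>, hence a limit of functions that
  depend on \<open>(y, t)\<close> only through a countable grid.\<close>

lemma rate_at_measurable:
  assumes [measurable]: "f \<in> measurable M lam" "g \<in> borel_measurable M" "h \<in> borel_measurable M"
  shows "(\<lambda>x. rate_at (f x) (g x) (h x)) \<in> borel_measurable M"
proof (rule borel_measurable_LIMSEQ_metric)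
  define r where "r n x = real_of_int \<lfloor>real (Suc n) * x\<rfloor> / real (Suc n)" for n x
  have r: "(\<lambda>n. r n x) \<longlonglongrightarrow> x" for x
  proof (rule tendsto_sandwich)
    have "x - 1 / real (Suc n) \<le> r n x" for n
    proof -
      have "(real (Suc n) * x - 1) / real (Suc n) \<le> r n x"
        unfolding r_def by (intro divide_right_mono) linarith+
      then show ?thesis by (simp add: diff_divide_distrib)
    qed
    then show "\<forall>\<^sub>F n in sequentially. x - 1 / real (Suc n) \<le> r n x" by simp
    have "r n x \<le> x" for n
      unfolding r_def by (simp add: field_simps)
    then show "\<forall>\<^sub>F n in sequentially. r n x \<le> x" by simp
    show "(\<lambda>n. x - 1 / real (Suc n)) \<longlonglongrightarrow> x"
      using tendsto_diff[OF tendsto_const LIMSEQ_inverse_real_of_nat, of x] by (simp add: inverse_eq_divide)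
  qed simp
  fix n
  show "(\<lambda>x. rate_at (f x) (r n (g x)) (r n (h x))) \<in> borel_measurable M"
  proof -
    have "(\<lambda>x. (\<lambda>(i, j) x. rate_at (f x) (real_of_int i / real (Suc n)) (real_of_int j / real (Suc n)))
        (\<lfloor>real (Suc n) * g x\<rfloor>, \<lfloor>real (Suc n) * h x\<rfloor>) x) \<in> borel_measurable M"
    proof (rule measurable_compose_countable)
      fix ij :: "int \<times> int"
      show "(\<lambda>x. (case ij of (i, j) \<Rightarrow> \<lambda>x. rate_at (f x) (real_of_int i / real (Suc n)) (real_of_int j / real (Suc n))) x)
          \<in> borel_measurable M"
        unfolding rate_at_def
        by (cases ij) (simp add: measurable_compose[OF assms(1) evaluation_measurable[OF clip_mem_rect]])
    qed measurable
    then show ?thesis by (simp add: r_def)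
  qed
  fix x assume "x \<in> space M"
  then have "f x \<in> W" using measurable_space[OF assms(1)] space_lam by auto
  then have "continuous_on UNIV (\<lambda>p. rate_at (f x) (fst p) (snd p))"
    by (intro rate_at_continuous continuous_intros)
  then have "(\<lambda>n. (\<lambda>p. rate_at (f x) (fst p) (snd p)) (r n (g x), r n (h x)))
      \<longlonglongrightarrow> (\<lambda>p. rate_at (f x) (fst p) (snd p)) (g x, h x)"
    by (rule continuous_on_tendsto_compose) (auto intro!: tendsto_intros r)
  then show "(\<lambda>n. rate_at (f x) (r n (g x)) (r n (h x))) \<longlonglongrightarrow> rate_at (f x) (g x) (h x)"
    by simp
qed

definition first_rate :: "((real \<times> real) \<times> real \<Rightarrow> real) \<Rightarrow> (real \<times> real \<Rightarrow> real) \<times> real \<Rightarrow> real \<Rightarrow> real" where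
  "first_rate \<theta> x u = rate_at (fst x) (\<theta> ((clip 0 1 (snd x), 0), clip 0 T u)) u"

text \<open>The maximum keeps the argument of \<open>\<theta>\<close> in \<open>Delta T\<close> when
  \<open>u < s\<close>; on the relevant range \<open>s \<le> u\<close> it returns
  \<open>u\<close>.\<close>

definition next_rate :: "((real \<times> real) \<times> real \<Rightarrow> real) \<Rightarrow> (real \<times> real \<Rightarrow> real) \<times> real \<Rightarrow> real \<Rightarrow> real \<Rightarrow> real" where
  "next_rate \<theta> x s u = rate_at (fst x) (\<theta> ((0, clip 0 T s), max (clip 0 T s) (clip 0 T u))) u"

text \<open>\<open>sig\<close> is measurable only over \<open>[0, 1]\<close>, hence the clipping;
  the half-open range of \<open>z\<close> is the one in \<open>Gmap\<close>.\<close>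

definition initial_law :: "((real \<times> real \<Rightarrow> real) \<times> real) measure" where
  "initial_law = density (lam \<Otimes>\<^sub>M lborel)
    (\<lambda>x. indicator {0..<1} (snd x) * ennreal (sig (fst x) (clip 0 1 (snd x))))"

lemma sig_clip_measurable [measurable]:
  "(\<lambda>x. sig (fst x) (clip 0 1 (snd x))) \<in> borel_measurable (lam \<Otimes>\<^sub>M lborel)"
proof -
  have "(\<lambda>x. (fst x, clip 0 1 (snd x))) \<in> measurable (lam \<Otimes>\<^sub>M lborel) (lam \<Otimes>\<^sub>M restrict_space lborel {0..1})"
    by (intro measurable_Pair measurable_restrict_space2) (auto simp: clip_bounds)
  from measurable_compose[OF this sig_meas] show ?thesis by simp
qed

lemma sets_initial_law [measurable_cong]: "sets initial_law = sets (lam \<Otimes>\<^sub>M lborel)"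
  by (simp add: initial_law_def)

lemma space_initial_law: "space initial_law = W \<times> UNIV"
  by (simp add: initial_law_def space_pair_measure space_lam)

lemma nn_integral_initial_law:
  assumes "f \<in> borel_measurable (lam \<Otimes>\<^sub>M lborel)"
  shows "(\<integral>\<^sup>+x. f x \<partial>initial_law)
    = (\<integral>\<^sup>+x. indicator {0..<1} (snd x) * ennreal (sig (fst x) (clip 0 1 (snd x))) * f x \<partial>(lam \<Otimes>\<^sub>M lborel))"
  unfolding initial_law_def by (rule nn_integral_density) (use assms in measurable)

text \<open>The marginal in \<open>w\<close> is \<open>lam\<close>, since \<open>sig w\<close>
  integrates to 1 over \<open>z\<close>. So the initial law is a probability measure and the mean of
  \<open>supn T\<close> under it is \<open>M_W\<close>.\<close>

lemma nn_integral_initial_law_fst: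
  assumes [measurable]: "f \<in> borel_measurable lam"
  shows "(\<integral>\<^sup>+x. f (fst x) \<partial>initial_law) = (\<integral>\<^sup>+w. f w \<partial>lam)"
proof -
  have "(\<integral>\<^sup>+x. f (fst x) \<partial>initial_law)
      = (\<integral>\<^sup>+w. \<integral>\<^sup>+z. indicator {0..<1} z * ennreal (sig w (clip 0 1 z)) * f w \<partial>lborel \<partial>lam)"
    by (subst nn_integral_initial_law, simp, subst lborel.nn_integral_fst[symmetric]) auto
  also have "\<dots> = (\<integral>\<^sup>+w. f w \<partial>lam)"
  proof (rule nn_integral_cong)
    fix w assume "w \<in> space lam"
    then have "w \<in> W" by (simp add: space_lam)
    have [measurable]: "(\<lambda>z. sig w (clip 0 1 z)) \<in> borel_measurable lborel"
      using measurable_compose[OF measurable_Pair1'[OF \<open>w \<in> space lam\<close>, of lborel] sig_clip_measurable] by simp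
    \<comment> \<open>\<open>sig\<close> is normalized over the closed interval and the law lives on
      the half-open one; they differ by a null set.\<close>
    have "AE z in lborel. z \<noteq> (1 :: real)"
      by (rule AE_lborel_singleton)
    then have "(\<integral>\<^sup>+z. indicator {0..<1} z * ennreal (sig w (clip 0 1 z)) * f w \<partial>lborel)
      = (\<integral>\<^sup>+z. f w * (ennreal (sig w (clip 0 1 z)) * indicator {0..1} z) \<partial>lborel)"
      by (intro nn_integral_cong_AE) (auto elim!: eventually_mono simp: indicator_def ac_simps)
    also have "\<dots> = f w * (\<integral>\<^sup>+z. ennreal (sig w (clip 0 1 z)) * indicator {0..1} z \<partial>lborel)"
      by (rule nn_integral_cmult) measurable
    also have "(\<integral>\<^sup>+z. ennreal (sig w (clip 0 1 z)) * indicator {0..1} z \<partial>lborel)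
        = (\<integral>\<^sup>+ z\<in>{0..1}. ennreal (sig w z) \<partial>lborel)"
      by (intro nn_integral_cong) (auto simp: indicator_def)
    finally show "(\<integral>\<^sup>+z. indicator {0..<1} z * ennreal (sig w (clip 0 1 z)) * f w \<partial>lborel) = f w"
      by (simp add: sig_int_z \<open>w \<in> W\<close>)
  qed
  finally show ?thesis .
qed

text \<open>The marginal in \<open>z\<close> is Lebesgue measure on \<open>[0, 1)\<close>, since
  \<open>sig\<close> integrates to 1 over \<open>w\<close>; it yields the constant 1 for changes of
  \<open>y0\<close>.\<close>

lemma nn_integral_initial_law_snd:
  assumes [measurable]: "f \<in> borel_measurable lborel"
  shows "(\<integral>\<^sup>+x. f (snd x) \<partial>initial_law) = (\<integral>\<^sup>+z. indicator {0..<1} z * f z \<partial>lborel)"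
proof -
  have "(\<integral>\<^sup>+x. f (snd x) \<partial>initial_law)
      = (\<integral>\<^sup>+z. \<integral>\<^sup>+w. indicator {0..<1} z * ennreal (sig w (clip 0 1 z)) * f z \<partial>lam \<partial>lborel)"
    by (subst nn_integral_initial_law, simp, subst nn_integral_snd[symmetric]) auto
  also have "\<dots> = (\<integral>\<^sup>+z. indicator {0..<1} z * f z \<partial>lborel)"
  proof (rule nn_integral_cong)
    fix z :: real
    have [measurable]: "(\<lambda>w. sig w (clip 0 1 z)) \<in> borel_measurable lam"
      using measurable_compose[OF measurable_Pair2'[of z lborel lam] sig_clip_measurable] by simp
    have "(\<integral>\<^sup>+w. indicator {0..<1} z * ennreal (sig w (clip 0 1 z)) * f z \<partial>lam)
      = (\<integral>\<^sup>+w. (indicator {0..<1} z * f z) * ennreal (sig w (clip 0 1 z)) \<partial>lam)"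
      by (simp add: ac_simps)
    also have "\<dots> = (indicator {0..<1} z * f z) * (\<integral>\<^sup>+w. ennreal (sig w (clip 0 1 z)) \<partial>lam)"
      by (rule nn_integral_cmult) measurable
    also have "\<dots> = indicator {0..<1} z * f z"
      by (simp add: sig_int_w clip_bounds)
    finally show "(\<integral>\<^sup>+w. indicator {0..<1} z * ennreal (sig w (clip 0 1 z)) * f z \<partial>lam) = indicator {0..<1} z * f z" .
  qed
  finally show ?thesis .
qed

sublocale initial_law: prob_space initial_law
proof
  show "emeasure initial_law (space initial_law) = 1"
    using nn_integral_initial_law_fst[of "\<lambda>_. 1"] lam.emeasure_space_1 by simp
qed

lemma integral_indicator_snd:
  assumes "0 \<le> a" "a \<le> b" "b \<le> 1"
  shows "(\<integral>x. indicator {a..<b} (snd x) \<partial>initial_law) = b - a"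
proof -
  have "(\<integral>x. indicator {a..<b} (snd x) \<partial>initial_law) = enn2real (\<integral>\<^sup>+x. indicator {a..<b} (snd x) \<partial>initial_law)"
    by (subst integral_eq_nn_integral) (auto simp: ennreal_indicator)
  also have "(\<integral>\<^sup>+x. indicator {a..<b} (snd x) \<partial>initial_law) = (\<integral>\<^sup>+z. indicator {a..<b} z \<partial>lborel)"
    unfolding nn_integral_initial_law_snd[of "indicator {a..<b}", simplified]
    using assms by (intro nn_integral_cong) (auto simp: indicator_def)
  also have "\<dots> = ennreal (b - a)"
    using assms by simp
  finally show ?thesis using assms by simp
qed

lemma supn_nonneg: "w \<in> W \<Longrightarrow> 0 \<le> supn T w"
  using rate_at_bounds[of w 0 0] by simp

lemma integrable_supn_fst: "integrable initial_law (\<lambda>x. supn T (fst x))"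
proof (rule integrableI_nonneg)
  have [measurable]: "supn T \<in> borel_measurable lam" using M_W by simp
  show "(\<lambda>x. supn T (fst x)) \<in> borel_measurable initial_law" by measurable
  show "AE x in initial_law. 0 \<le> supn T (fst x)"
    by (intro AE_I2) (auto simp: space_initial_law supn_nonneg)
  have "(\<integral>\<^sup>+x. ennreal (supn T (fst x)) \<partial>initial_law) = (\<integral>\<^sup>+w. ennreal (supn T w) \<partial>lam)"
    by (rule nn_integral_initial_law_fst) measurable
  also have "\<dots> < \<infinity>"
    using M_W by (subst nn_integral_eq_integral) (auto simp: space_lam supn_nonneg)
  finally show "(\<integral>\<^sup>+x. ennreal (supn T (fst x)) \<partial>initial_law) < \<infinity>" .
qed

lemma AE_initial_law_snd: "AE x in initial_law. snd x \<in> {0..<1}"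
proof -
  have "AE x in lam \<Otimes>\<^sub>M lborel. 0 < indicator {0..<1} (snd x) * ennreal (sig (fst x) (clip 0 1 (snd x)))
      \<longrightarrow> snd x \<in> {0..<1}"
    by (intro AE_I2) (auto simp: indicator_def)
  then show ?thesis
    unfolding initial_law_def by (subst AE_density) auto
qed

end

section \<open>The probability of being ahead\<close>

lemma Delta_mono: "(\<gamma>, t) \<in> Delta T \<Longrightarrow> t \<le> t' \<Longrightarrow> t' \<le> T \<Longrightarrow> (\<gamma>, t') \<in> Delta T"
  by (cases \<gamma>) (auto simp: mem_Delta)

lemma prodf_eq_path_density:
  "prodf \<theta> w z t (Suc k) u = path_density (\<lambda>u. w (\<theta> ((z, 0), u), u)) (\<lambda>s u. w (\<theta> ((0, s), u), u)) (Suc k) u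
     * surv (\<lambda>v. w (\<theta> ((0, u k), v), v)) (u k) t"
  by (simp add: prodf_def path_density_def surv_def Om_z_def Om_def)

text \<open>Translates ordered multiple integrals into the renewal recursion. The literal rates are
  not controlled outside the domain, so they are replaced by total bounded rates that agree with
  them on times up to \<open>t\<close>.\<close>

lemma termk_eq:
  assumes t: "t0 \<le> t"
    and r: "renewal \<alpha> \<beta> B"
    and first: "\<And>u. 0 \<le> u \<Longrightarrow> u \<le> t \<Longrightarrow> \<alpha> u = w (\<theta> ((z, 0), u), u)"
    and later: "\<And>s u. 0 \<le> s \<Longrightarrow> s \<le> u \<Longrightarrow> u \<le> t \<Longrightarrow> \<beta> s u = w (\<theta> ((0, s), u), u)"
  shows "termk \<theta> w z t0 t (Suc k) = last_jump_before \<alpha> \<beta> k t0 t"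
proof -
  interpret renewal \<alpha> \<beta> B by (rule r)
  have "termk \<theta> w z t0 t (Suc k) = (\<integral>\<^sup>+u. indicator (osimplex (Suc k) t0) u
      * (ennreal (path_density \<alpha> \<beta> (Suc k) u) * ennreal (surv (\<beta> (u k)) (u k) t)) \<partial>(\<Pi>\<^sub>M i\<in>{..<Suc k}. lborel))"
    unfolding termk_def
  proof (intro nn_integral_cong)
    fix u
    show "indicator (osimplex (Suc k) t0) u * ennreal (prodf \<theta> w z t (Suc k) u)
      = indicator (osimplex (Suc k) t0) u * (ennreal (path_density \<alpha> \<beta> (Suc k) u) * ennreal (surv (\<beta> (u k)) (u k) t))"
    proof (cases "u \<in> osimplex (Suc k) t0")
      case True
      have "prodf \<theta> w z t (Suc k) u = path_density \<alpha> \<beta> (Suc k) u * surv (\<beta> (u k)) (u k) t"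
        unfolding prodf_eq_path_density using first later by (intro path_density_cong[OF True t, symmetric]) auto
      then show ?thesis by (simp add: ennreal_mult path_density_nonneg)
    qed simp
  qed
  also have "\<dots> = last_jump_before \<alpha> \<beta> k t0 t"
    unfolding last_jump_before_def by (rule nn_integral_path_density) measurable
  finally show ?thesis .
qed

text \<open>Causality: \<open>Om_z\<close> and \<open>prodf\<close> read \<open>\<theta>\<close>
  only at times up to \<open>t\<close>, so the integrands already agree pointwise.\<close>

lemma Gmap_cong:
  assumes p: "(\<gamma>, t) \<in> Delta T"
    and eq: "\<And>\<gamma>' s. (\<gamma>', s) \<in> Delta T \<Longrightarrow> s \<le> t \<Longrightarrow> \<theta> (\<gamma>', s) = \<theta>' (\<gamma>', s)"
  shows "Gmap lam sig \<theta> (\<gamma>, t) = Gmap lam sig \<theta>' (\<gamma>, t)"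
proof -
  obtain y0 t0 where \<gamma>: "\<gamma> = (y0, t0)" by (cases \<gamma>)
  have b: "0 \<le> t0" "t0 \<le> t" "t \<le> T" "0 \<le> y0" using p by (auto simp: \<gamma> mem_Delta)
  have O: "Om_z \<theta> w z t = Om_z \<theta>' w z t" if "z \<in> {0..1}" for w z
    unfolding Om_z_def using that b by (intro integral_cong) (simp add: eq mem_Delta)
  have K: "termk \<theta> w z t0 t (Suc k) = termk \<theta>' w z t0 t (Suc k)" if "z \<in> {0..1}" for w z k
    unfolding termk_def
  proof (intro nn_integral_cong)
    fix u
    have "prodf \<theta> w z t (Suc k) u = prodf \<theta>' w z t (Suc k) u" if "u \<in> osimplex (Suc k) t0"
      unfolding prodf_eq_path_density using \<open>z \<in> {0..1}\<close> b
      by (intro path_density_cong[OF that b(2)]) (simp_all add: eq mem_Delta)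
    then show "indicator (osimplex (Suc k) t0) u * ennreal (prodf \<theta> w z t (Suc k) u)
      = indicator (osimplex (Suc k) t0) u * ennreal (prodf \<theta>' w z t (Suc k) u)"
      by (auto simp: indicator_def)
  qed
  show ?thesis
    unfolding Gmap_def \<gamma> prod.case using b
    by (intro if_cong refl arg_cong2[where f="(-)"] arg_cong[where f=enn2real] nn_integral_cong)
       (auto simp: indicator_def O K)
qed

section \<open>Measurability of the rates, and \<open>Gmap\<close> as an expectation\<close>

context particle_system
begin

lemma first_arg_continuous:
  assumes "continuous_on (Delta T) \<theta>"
  shows "continuous_on UNIV (\<lambda>p. \<theta> ((clip 0 1 (fst p), 0), clip 0 T (snd p)))"
  using T_pos
  by (intro continuous_on_compose2[OF assms] continuous_intros) (auto simp: mem_Delta clip_bounds)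

lemma next_arg_continuous:
  assumes "continuous_on (Delta T) \<theta>"
  shows "continuous_on UNIV (\<lambda>p. \<theta> ((0, clip 0 T (fst p)), max (clip 0 T (fst p)) (clip 0 T (snd p))))"
  using T_pos
  by (intro continuous_on_compose2[OF assms] continuous_intros) (auto simp: mem_Delta clip_bounds)

lemma first_rate_measurable:
  assumes "continuous_on (Delta T) \<theta>"
  shows "(\<lambda>q. first_rate \<theta> (fst q) (snd q)) \<in> borel_measurable (initial_law \<Otimes>\<^sub>M borel)"
  unfolding first_rate_def
proof (rule rate_at_measurable)
  have m: "(\<lambda>p. \<theta> ((clip 0 1 (fst p), 0), clip 0 T (snd p))) \<in> borel_measurable (borel \<Otimes>\<^sub>M borel)"
    unfolding borel_prod by (rule borel_measurable_continuous_onI[OF first_arg_continuous[OF assms]])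
  have "(\<lambda>q. (snd (fst q), snd q)) \<in> measurable (initial_law \<Otimes>\<^sub>M borel) (borel \<Otimes>\<^sub>M borel)"
    by measurable
  from measurable_compose[OF this m]
  show "(\<lambda>q. \<theta> ((clip 0 1 (snd (fst q)), 0), clip 0 T (snd q))) \<in> borel_measurable (initial_law \<Otimes>\<^sub>M borel)"
    by simp
qed measurable

lemma next_rate_measurable:
  assumes "continuous_on (Delta T) \<theta>"
  shows "(\<lambda>q. next_rate \<theta> (fst q) (fst (snd q)) (snd (snd q)))
    \<in> borel_measurable (initial_law \<Otimes>\<^sub>M (borel \<Otimes>\<^sub>M borel))"
  unfolding next_rate_def
proof (rule rate_at_measurable)
  have m: "(\<lambda>p. \<theta> ((0, clip 0 T (fst p)), max (clip 0 T (fst p)) (clip 0 T (snd p)))) \<in> borel_measurable (borel \<Otimes>\<^sub>M borel)"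
    unfolding borel_prod by (rule borel_measurable_continuous_onI[OF next_arg_continuous[OF assms]])
  show "(\<lambda>q. \<theta> ((0, clip 0 T (fst (snd q))), max (clip 0 T (fst (snd q))) (clip 0 T (snd (snd q)))))
      \<in> borel_measurable (initial_law \<Otimes>\<^sub>M (borel \<Otimes>\<^sub>M borel))"
    by (rule measurable_compose[OF measurable_snd m])
qed measurable

lemma renewal_rates:
  assumes \<theta>: "continuous_on (Delta T) \<theta>" and x: "x \<in> space initial_law"
  shows "renewal (first_rate \<theta> x) (next_rate \<theta> x) (supn T (fst x))"
proof -
  have w: "fst x \<in> W" using x by (auto simp: space_initial_law)
  have "continuous_on UNIV (\<lambda>u. \<theta> ((clip 0 1 (snd x), 0), clip 0 T u))"
    using continuous_on_compose2[OF first_arg_continuous[OF \<theta>], of UNIV "\<lambda>u. (snd x, u)"]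
    by (simp add: continuous_intros)
  then have 1: "bounded_rate (first_rate \<theta> x) (supn T (fst x))"
    unfolding first_rate_def by unfold_locales (auto intro!: rate_at_continuous rate_at_bounds continuous_intros w)
  have "continuous_on UNIV (\<lambda>u. \<theta> ((0, clip 0 T s), max (clip 0 T s) (clip 0 T u)))" for s
    using continuous_on_compose2[OF next_arg_continuous[OF \<theta>], of UNIV "\<lambda>u. (s, u)"]
    by (simp add: continuous_intros)
  then have 2: "bounded_rate (next_rate \<theta> x s) (supn T (fst x))" for s
    unfolding next_rate_def by unfold_locales (auto intro!: rate_at_continuous rate_at_bounds continuous_intros w)
  have "continuous_on UNIV (\<lambda>p. next_rate \<theta> x (fst p) (snd p))"
    unfolding next_rate_def by (intro rate_at_continuous next_arg_continuous w \<theta> continuous_intros)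
  then have 3: "(\<lambda>p. next_rate \<theta> x (fst p) (snd p)) \<in> borel_measurable (borel \<Otimes>\<^sub>M borel)"
    unfolding borel_prod by (rule borel_measurable_continuous_onI)
  show ?thesis using 1 2 3 by (rule renewal.intro)
qed

text \<open>One formula for both branches of \<open>Gmap\<close>: if \<open>t0 = 0\<close> the
  second factor is plain survival, and if \<open>t0 > 0\<close> then \<open>y0 = 0\<close> and the
  indicator is almost surely 1. The bound \<open>z < 1\<close> is part of
  \<open>initial_law\<close>.\<close>

definition ahead :: "((real \<times> real) \<times> real \<Rightarrow> real) \<Rightarrow> (real \<times> real) \<times> real
    \<Rightarrow> (real \<times> real \<Rightarrow> real) \<times> real \<Rightarrow> real" where
  "ahead \<theta> p x = indicator {fst (fst p)..} (snd x)
     * no_jump_since (first_rate \<theta> x) (next_rate \<theta> x) (snd (fst p)) (snd p)"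

lemma ahead_measurable:
  assumes "continuous_on (Delta T) \<theta>"
  shows "ahead \<theta> p \<in> borel_measurable initial_law"
proof -
  have [measurable]: "(\<lambda>x. no_jump_since (first_rate \<theta> x) (next_rate \<theta> x) (snd (fst p)) (snd p))
      \<in> borel_measurable initial_law"
    by (rule no_jump_since_measurable[OF _ _ first_rate_measurable next_rate_measurable])
       (use assms renewal_rates in \<open>auto simp: renewal_def bounded_rate_def\<close>)
  show ?thesis unfolding ahead_def by measurable
qed

lemma ahead_bounds:
  assumes \<theta>: "continuous_on (Delta T) \<theta>" and x: "x \<in> space initial_law" and p: "p \<in> Delta T"
  shows "0 \<le> ahead \<theta> p x" "ahead \<theta> p x \<le> 1"
proof -
  interpret renewal "first_rate \<theta> x" "next_rate \<theta> x" "supn T (fst x)"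
    by (rule renewal_rates[OF \<theta> x])
  show "0 \<le> ahead \<theta> p x" unfolding ahead_def by (simp add: no_jump_since_nonneg)
  show "ahead \<theta> p x \<le> 1"
    using p unfolding ahead_def
    by (cases p; cases "fst p") (auto simp: mem_Delta indicator_def intro!: no_jump_since_le_1)
qed

lemma ahead_integrable:
  assumes "continuous_on (Delta T) \<theta>" "p \<in> Delta T"
  shows "integrable initial_law (ahead \<theta> p)"
  by (rule initial_law.integrable_const_bound[where B=1])
     (use ahead_bounds[OF assms(1) _ assms(2)] ahead_measurable[OF assms(1)] in auto)

text \<open>From here on, properties of \<open>Gmap\<close> follow from properties of
  \<open>ahead\<close> for one particle, by integration against a probability measure.\<close>

lemma Gmap_eq:
  assumes \<theta>: "continuous_on (Delta T) \<theta>" and rng: "\<And>p. p \<in> Delta T \<Longrightarrow> \<theta> p \<in> {0..1}"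
    and p: "p \<in> Delta T"
  shows "Gmap lam sig \<theta> p = 1 - (\<integral>x. ahead \<theta> p x \<partial>initial_law)"
proof -
  obtain y0 t0 t where p_eq: "p = ((y0, t0), t)" by (metis prod.exhaust)
  have b: "0 \<le> y0" "y0 \<le> 1" "0 \<le> t0" "t0 \<le> t" "t \<le> T" "y0 = 0 \<or> t0 = 0"
    using p by (auto simp: p_eq mem_Delta)
  let ?\<alpha> = "first_rate \<theta>" and ?\<beta> = "next_rate \<theta>"
  let ?d = "\<lambda>x. indicator {0..<1} (snd x) * ennreal (sig (fst x) (clip 0 1 (snd x)))"
  let ?L = "\<lambda>x. \<Sum>k. last_jump_before (?\<alpha> x) (?\<beta> x) k t0 t"
  have \<alpha>: "?\<alpha> x u = fst x (\<theta> ((snd x, 0), u), u)" if "snd x \<in> {0..1}" "0 \<le> u" "u \<le> t" for x u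
    using that b rng[of "((snd x, 0), u)"] by (simp add: first_rate_def rate_at_def mem_Delta)
  have \<beta>: "?\<beta> x s u = fst x (\<theta> ((0, s), u), u)" if "0 \<le> s" "s \<le> u" "u \<le> t" for x s u
    using that b rng[of "((0, s), u)"] by (simp add: next_rate_def rate_at_def mem_Delta max_absorb2)
  have O: "exp (- Om_z \<theta> (fst x) (snd x) t) = surv (?\<alpha> x) 0 t" if "snd x \<in> {0..1}" for x
    unfolding Om_z_def surv_def using \<alpha>[OF that] by (auto intro!: integral_cong)
  have K: "termk \<theta> (fst x) (snd x) t0 t (Suc k) = last_jump_before (?\<alpha> x) (?\<beta> x) k t0 t"
    if "snd x \<in> {0..1}" "x \<in> space initial_law" for x k
    by (rule termk_eq[OF b(4) renewal_rates[OF \<theta> that(2)]]) (use \<alpha>[OF that(1)] \<beta> in auto)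
  have [measurable]: "(\<lambda>x. surv (?\<alpha> x) 0 t) \<in> borel_measurable (lam \<Otimes>\<^sub>M lborel)"
  proof -
    have "(\<lambda>x. surv (?\<alpha> x) 0 t) \<in> borel_measurable initial_law"
      by (rule surv_measurable[OF _ first_rate_measurable[OF \<theta>]])
         (use renewal_rates[OF \<theta>] in \<open>auto simp: renewal_def bounded_rate_def\<close>)
    then show ?thesis by simp
  qed
  have [measurable]: "(\<lambda>x. last_jump_before (?\<alpha> x) (?\<beta> x) k t0 t) \<in> borel_measurable (lam \<Otimes>\<^sub>M lborel)" for k
  proof -
    have "(\<lambda>x. last_jump_before (?\<alpha> x) (?\<beta> x) k t0 t) \<in> borel_measurable initial_law"
      by (rule last_jump_before_measurable[OF _ _ first_rate_measurable[OF \<theta>] next_rate_measurable[OF \<theta>]])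
         (use renewal_rates[OF \<theta>] in \<open>auto simp: renewal_def bounded_rate_def\<close>)
    then show ?thesis by simp
  qed
  have am [measurable]: "ahead \<theta> p \<in> borel_measurable (lam \<Otimes>\<^sub>M lborel)"
    using ahead_measurable[OF \<theta>, of p] by simp
  have "(\<integral>x. ahead \<theta> p x \<partial>initial_law) = enn2real (\<integral>\<^sup>+x. ennreal (ahead \<theta> p x) \<partial>initial_law)"
    using ahead_bounds[OF \<theta> _ p] ahead_measurable[OF \<theta>, of p]
    by (intro integral_eq_nn_integral) auto
  also have "(\<integral>\<^sup>+x. ennreal (ahead \<theta> p x) \<partial>initial_law) = (\<integral>\<^sup>+x. ?d x * ennreal (ahead \<theta> p x) \<partial>(lam \<Otimes>\<^sub>M lborel))"
    by (rule nn_integral_initial_law) measurable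
  finally have int: "(\<integral>x. ahead \<theta> p x \<partial>initial_law) = enn2real (\<integral>\<^sup>+x. ?d x * ennreal (ahead \<theta> p x) \<partial>(lam \<Otimes>\<^sub>M lborel))" .
  have sp: "space initial_law = space (lam \<Otimes>\<^sub>M lborel)" by (simp add: initial_law_def)
  have nonneg: "0 \<le> sig (fst x) (snd x)" if "x \<in> space initial_law" "snd x \<in> {0..1}" for x
    using that by (auto simp: space_initial_law intro: sig_nonneg)
  have first: "(indicator (space lam \<times> {y0..<1}) x * ennreal (exp (- Om_z \<theta> (fst x) (snd x) t) * sig (fst x) (snd x)))
      = ?d x * (indicator {y0..} (snd x) * ennreal (surv (?\<alpha> x) 0 t))" if "x \<in> space initial_law" for x
  proof (cases "snd x \<in> {0..<1}")
    case True
    then show ?thesis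
      using that b nonneg[OF that] O[of x]
      by (auto simp: indicator_def space_initial_law space_lam ennreal_mult ac_simps)
  qed (use b in \<open>auto simp: indicator_def mem_Times_iff\<close>)
  show ?thesis
  proof (cases "t0 = 0")
    case True
    \<comment> \<open>A last jump in the null set \<open>{0..0}\<close> has probability 0, which
      matches the branch of \<open>Gmap\<close> without a series.\<close>
    have z: "no_jump_since (?\<alpha> x) (?\<beta> x) 0 t = surv (?\<alpha> x) 0 t" for x
    proof -
      have "last_jump_before (?\<alpha> x) (?\<beta> x) k 0 t = 0" for k
      proof -
        have "last_jump_before (?\<alpha> x) (?\<beta> x) k 0 t = (\<integral>\<^sup>+u. 0 \<partial>(lborel :: real measure))"
          unfolding last_jump_before_def
          by (intro nn_integral_cong_AE) (use AE_lborel_singleton[of "0 :: real"] in \<open>auto elim!: eventually_mono\<close>)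
        then show ?thesis by simp
      qed
      then show ?thesis by (simp add: no_jump_since_def)
    qed
    have "(\<integral>\<^sup>+x. indicator (space lam \<times> {y0..<1}) x * ennreal (exp (- Om_z \<theta> (fst x) (snd x) t) * sig (fst x) (snd x)) \<partial>(lam \<Otimes>\<^sub>M lborel))
      = (\<integral>\<^sup>+x. ?d x * ennreal (ahead \<theta> p x) \<partial>(lam \<Otimes>\<^sub>M lborel))"
    proof (rule nn_integral_cong)
      fix x :: "(real \<times> real \<Rightarrow> real) \<times> real" assume "x \<in> space (lam \<Otimes>\<^sub>M lborel)"
      then show "indicator (space lam \<times> {y0..<1}) x * ennreal (exp (- Om_z \<theta> (fst x) (snd x) t) * sig (fst x) (snd x))
        = ?d x * ennreal (ahead \<theta> p x)"
        by (subst first) (auto simp: sp ahead_def p_eq True z ennreal_mult ennreal_indicator)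
    qed
    then show ?thesis using int by (simp add: Gmap_def p_eq True)
  next
    case False
    with b have "y0 = 0" by simp
    have split: "?d x * ennreal (ahead \<theta> p x) = ?d x * ennreal (surv (?\<alpha> x) 0 t) + ?d x * ?L x"
      if "x \<in> space initial_law" for x
    proof (cases "snd x \<in> {0..<1}")
      case True
      interpret renewal "first_rate \<theta> x" "next_rate \<theta> x" "supn T (fst x)"
        by (rule renewal_rates[OF \<theta> that])
      have "ennreal (ahead \<theta> p x) = ennreal (surv (?\<alpha> x) 0 t) + ?L x"
        using True no_jump_since_ge[of t t0] unfolding suminf_last_jump_before_finite[OF b(3,4)]
        by (simp add: ahead_def p_eq \<open>y0 = 0\<close> ennreal_plus[symmetric] del: ennreal_plus)
      then show ?thesis by (simp add: distrib_left)
    qed simp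
    have "(\<integral>\<^sup>+x. ?d x * ennreal (ahead \<theta> p x) \<partial>(lam \<Otimes>\<^sub>M lborel))
      = (\<integral>\<^sup>+x. ?d x * ennreal (surv (?\<alpha> x) 0 t) + ?d x * ?L x \<partial>(lam \<Otimes>\<^sub>M lborel))"
      using split by (intro nn_integral_cong) (simp add: sp)
    also have "\<dots> = (\<integral>\<^sup>+x. ?d x * ennreal (surv (?\<alpha> x) 0 t) \<partial>(lam \<Otimes>\<^sub>M lborel))
        + (\<integral>\<^sup>+x. ?d x * ?L x \<partial>(lam \<Otimes>\<^sub>M lborel))" (is "_ = ?A + ?R")
      by (rule nn_integral_add) measurable
    finally have eq: "(\<integral>\<^sup>+x. ?d x * ennreal (ahead \<theta> p x) \<partial>(lam \<Otimes>\<^sub>M lborel)) = ?A + ?R" .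
    \<comment> \<open>\<open>enn2real\<close> splits over a sum only for finite summands; here the
      sum is the expectation of a function bounded by 1.\<close>
    have "(\<integral>\<^sup>+x. ?d x * ennreal (ahead \<theta> p x) \<partial>(lam \<Otimes>\<^sub>M lborel)) = (\<integral>\<^sup>+x. ennreal (ahead \<theta> p x) \<partial>initial_law)"
      by (rule nn_integral_initial_law[symmetric]) measurable
    also have "\<dots> \<le> (\<integral>\<^sup>+x. 1 \<partial>initial_law)"
      using ahead_bounds[OF \<theta> _ p] by (intro nn_integral_mono) auto
    also have "\<dots> < \<infinity>" using initial_law.emeasure_space_1 by simp
    finally have fin: "?A < \<infinity>" "?R < \<infinity>" unfolding eq by auto
    have A: "(\<integral>\<^sup>+x. indicator (space lam \<times> {0..<1}) x * ennreal (exp (- Om_z \<theta> (fst x) (snd x) t) * sig (fst x) (snd x)) \<partial>(lam \<Otimes>\<^sub>M lborel)) = ?A"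
    proof (rule nn_integral_cong)
      fix x :: "(real \<times> real \<Rightarrow> real) \<times> real" assume x: "x \<in> space (lam \<Otimes>\<^sub>M lborel)"
      show "indicator (space lam \<times> {0..<1}) x * ennreal (exp (- Om_z \<theta> (fst x) (snd x) t) * sig (fst x) (snd x))
        = ?d x * ennreal (surv (?\<alpha> x) 0 t)"
        using first[of x] x by (auto simp: \<open>y0 = 0\<close> sp indicator_def)
    qed
    have R: "(\<integral>\<^sup>+x. indicator (space lam \<times> {0..<1}) x * (\<Sum>k. termk \<theta> (fst x) (snd x) t0 t (Suc k)) * ennreal (sig (fst x) (snd x)) \<partial>(lam \<Otimes>\<^sub>M lborel)) = ?R"
    proof (rule nn_integral_cong)
      fix x :: "(real \<times> real \<Rightarrow> real) \<times> real" assume "x \<in> space (lam \<Otimes>\<^sub>M lborel)"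
      then have x: "x \<in> space initial_law" by (simp add: sp)
      show "indicator (space lam \<times> {0..<1}) x * (\<Sum>k. termk \<theta> (fst x) (snd x) t0 t (Suc k)) * ennreal (sig (fst x) (snd x))
        = ?d x * ?L x"
      proof (cases "snd x \<in> {0..<1}")
        case True
        then have "x \<in> space lam \<times> {0..<1}" using x by (auto simp: space_initial_law space_lam)
        with True x show ?thesis by (simp add: K ac_simps)
      qed (auto simp: indicator_def mem_Times_iff)
    qed
    have "(\<integral>x. ahead \<theta> p x \<partial>initial_law) = enn2real ?A + enn2real ?R"
      unfolding int eq using fin by (simp add: enn2real_plus)
    then show ?thesis
      using False by (simp add: Gmap_def p_eq A R)
  qed
qed

end

section \<open>Delayed solutions and the fixed point\<close>

context particle_system
begin

text \<open>The part of membership in \<open>Theta T\<close> that is carried through the iteration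
  and the limit; one application of \<open>Gmap\<close> restores the rest, by
  \<open>Gmap_Theta\<close>.\<close>

definition admissible :: "((real \<times> real) \<times> real \<Rightarrow> real) \<Rightarrow> bool" where
  "admissible \<theta> \<longleftrightarrow> continuous_on (Delta T) \<theta> \<and> (\<forall>p\<in>Delta T. \<theta> p \<in> {0..1})"

text \<open>This is \<open>M_W\<close>, by the marginal of \<open>initial_law\<close> in
  \<open>w\<close>.\<close>

definition mean_rate :: real where
  "mean_rate = (\<integral>x. supn T (fst x) \<partial>initial_law)"

lemma mean_rate_nonneg: "0 \<le> mean_rate"
  unfolding mean_rate_def
  by (intro integral_nonneg_AE AE_I2) (auto simp: space_initial_law supn_nonneg)

lemma Gmap_eq': "admissible \<theta> \<Longrightarrow> p \<in> Delta T \<Longrightarrow> Gmap lam sig \<theta> p = 1 - (\<integral>x. ahead \<theta> p x \<partial>initial_law)"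
  by (rule Gmap_eq) (auto simp: admissible_def)

lemma ahead_integrable': "admissible \<theta> \<Longrightarrow> p \<in> Delta T \<Longrightarrow> integrable initial_law (ahead \<theta> p)"
  by (rule ahead_integrable) (auto simp: admissible_def)

lemma ahead_time:
  assumes \<theta>: "admissible \<theta>" and x: "x \<in> space initial_law"
    and p: "(\<gamma>, t) \<in> Delta T" "t \<le> t'"
  shows "ahead \<theta> (\<gamma>, t') x \<le> ahead \<theta> (\<gamma>, t) x"
    and "ahead \<theta> (\<gamma>, t) x \<le> ahead \<theta> (\<gamma>, t') x + supn T (fst x) * (t' - t)"
proof -
  interpret renewal "first_rate \<theta> x" "next_rate \<theta> x" "supn T (fst x)"
    using \<theta> x by (intro renewal_rates) (auto simp: admissible_def)
  obtain y s where \<gamma>: "\<gamma> = (y, s)" by (cases \<gamma>)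
  have s: "0 \<le> s" "s \<le> t" using p by (auto simp: \<gamma> mem_Delta)
  show "ahead \<theta> (\<gamma>, t') x \<le> ahead \<theta> (\<gamma>, t) x"
    using no_jump_since_antimono[OF s p(2)] by (simp add: ahead_def \<gamma> indicator_def)
  show "ahead \<theta> (\<gamma>, t) x \<le> ahead \<theta> (\<gamma>, t') x + supn T (fst x) * (t' - t)"
    using no_jump_since_lipschitz_end[OF s p(2)] B_nonneg p(2) by (simp add: ahead_def \<gamma> indicator_def)
qed

text \<open>On the axes that make up Gamma, \<open>y \<le> y'\<close> with \<open>s' \<le> s\<close>
  is exactly the order relation, so a passage from \<open>(0, s)\<close> to \<open>(y', 0)\<close>
  is included. The two error terms account for particles starting in \<open>[y, y')\<close> and for
  jumps between \<open>s'\<close> and \<open>s\<close>.\<close>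

lemma ahead_order:
  assumes \<theta>: "admissible \<theta>" and x: "x \<in> space initial_law"
    and p: "((y, s), t) \<in> Delta T" "((y', s'), t) \<in> Delta T" "y \<le> y'" "s' \<le> s"
  shows "ahead \<theta> ((y', s'), t) x \<le> ahead \<theta> ((y, s), t) x"
    and "ahead \<theta> ((y, s), t) x
      \<le> ahead \<theta> ((y', s'), t) x + (indicator {y..<y'} (snd x) + supn T (fst x) * (s - s'))"
proof -
  interpret renewal "first_rate \<theta> x" "next_rate \<theta> x" "supn T (fst x)"
    using \<theta> x by (intro renewal_rates) (auto simp: admissible_def)
  have s: "0 \<le> s'" "0 \<le> s" "s \<le> t" using p by (auto simp: mem_Delta)
  show "ahead \<theta> ((y', s'), t) x \<le> ahead \<theta> ((y, s), t) x"
    using no_jump_since_mono[OF s(1) p(4) s(3)] no_jump_since_nonneg p(3) by (auto simp: ahead_def indicator_def)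
  show "ahead \<theta> ((y, s), t) x
      \<le> ahead \<theta> ((y', s'), t) x + (indicator {y..<y'} (snd x) + supn T (fst x) * (s - s'))"
    using no_jump_since_lipschitz_start[OF s(1) p(4) s(3)] no_jump_since_le_1[OF s(2,3)] B_nonneg p(3,4)
    by (auto simp: ahead_def indicator_def intro: add_increasing2)
qed

section \<open>Monotonicity, Lipschitz bounds and boundary values of \<open>Gmap\<close>\<close>

lemma Gmap_time:
  assumes \<theta>: "admissible \<theta>" and p: "(\<gamma>, t) \<in> Delta T" "t \<le> t'" "t' \<le> T"
  shows "Gmap lam sig \<theta> (\<gamma>, t) \<le> Gmap lam sig \<theta> (\<gamma>, t')"
    and "Gmap lam sig \<theta> (\<gamma>, t') \<le> Gmap lam sig \<theta> (\<gamma>, t) + mean_rate * (t' - t)"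
proof -
  note q = Delta_mono[OF p]
  note i = ahead_integrable'[OF \<theta> p(1)] ahead_integrable'[OF \<theta> q] integrable_supn_fst
  have "(\<integral>x. ahead \<theta> (\<gamma>, t') x \<partial>initial_law) \<le> (\<integral>x. ahead \<theta> (\<gamma>, t) x \<partial>initial_law)"
    using i ahead_time[OF \<theta> _ p(1,2)] by (intro integral_mono) auto
  then show "Gmap lam sig \<theta> (\<gamma>, t) \<le> Gmap lam sig \<theta> (\<gamma>, t')"
    by (simp add: Gmap_eq' \<theta> p q)
  have "(\<integral>x. ahead \<theta> (\<gamma>, t) x \<partial>initial_law)
      \<le> (\<integral>x. ahead \<theta> (\<gamma>, t') x + supn T (fst x) * (t' - t) \<partial>initial_law)"
    using i ahead_time[OF \<theta> _ p(1,2)] by (intro integral_mono) auto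
  also have "\<dots> = (\<integral>x. ahead \<theta> (\<gamma>, t') x \<partial>initial_law) + mean_rate * (t' - t)"
    using i by (simp add: mean_rate_def)
  finally show "Gmap lam sig \<theta> (\<gamma>, t') \<le> Gmap lam sig \<theta> (\<gamma>, t) + mean_rate * (t' - t)"
    by (simp add: Gmap_eq' \<theta> p q)
qed

lemma Gmap_order:
  assumes \<theta>: "admissible \<theta>"
    and p: "((y, s), t) \<in> Delta T" "((y', s'), t) \<in> Delta T" "y \<le> y'" "s' \<le> s"
  shows "Gmap lam sig \<theta> ((y, s), t) \<le> Gmap lam sig \<theta> ((y', s'), t)"
    and "Gmap lam sig \<theta> ((y', s'), t) \<le> Gmap lam sig \<theta> ((y, s), t) + (y' - y) + mean_rate * (s - s')"
proof -
  note i = ahead_integrable'[OF \<theta> p(1)] ahead_integrable'[OF \<theta> p(2)] integrable_supn_fst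
  have ind: "integrable initial_law (\<lambda>x. indicator {y..<y'} (snd x) :: real)"
    by (rule initial_law.integrable_const_bound[where B=1]) auto
  have "(\<integral>x. ahead \<theta> ((y', s'), t) x \<partial>initial_law) \<le> (\<integral>x. ahead \<theta> ((y, s), t) x \<partial>initial_law)"
    using i ahead_order[OF \<theta> _ p] by (intro integral_mono) auto
  then show "Gmap lam sig \<theta> ((y, s), t) \<le> Gmap lam sig \<theta> ((y', s'), t)"
    by (simp add: Gmap_eq' \<theta> p)
  have "(\<integral>x. ahead \<theta> ((y, s), t) x \<partial>initial_law) \<le> (\<integral>x. ahead \<theta> ((y', s'), t) x
      + (indicator {y..<y'} (snd x) + supn T (fst x) * (s - s')) \<partial>initial_law)"
    using i ind ahead_order[OF \<theta> _ p] by (intro integral_mono) auto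
  also have "\<dots> = (\<integral>x. ahead \<theta> ((y', s'), t) x \<partial>initial_law) + ((y' - y) + mean_rate * (s - s'))"
    using i ind p integral_indicator_snd[of y y'] by (simp add: mean_rate_def mem_Delta)
  finally show "Gmap lam sig \<theta> ((y', s'), t) \<le> Gmap lam sig \<theta> ((y, s), t) + (y' - y) + mean_rate * (s - s')"
    by (simp add: Gmap_eq' \<theta> p)
qed

lemma Gmap_bounds:
  assumes \<theta>: "admissible \<theta>" and p: "p \<in> Delta T"
  shows "Gmap lam sig \<theta> p \<in> {0..1}"
proof -
  have b: "0 \<le> ahead \<theta> p x" "ahead \<theta> p x \<le> 1" if "x \<in> space initial_law" for x
    using ahead_bounds[OF _ that p] \<theta> by (auto simp: admissible_def)
  have "(\<integral>x. ahead \<theta> p x \<partial>initial_law) \<le> (\<integral>x. 1 \<partial>initial_law)"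
    using b ahead_integrable'[OF \<theta> p] by (intro integral_mono) auto
  moreover have "0 \<le> (\<integral>x. ahead \<theta> p x \<partial>initial_law)"
    using b by (intro integral_nonneg_AE AE_I2) auto
  ultimately show ?thesis
    using initial_law.prob_space by (simp add: Gmap_eq' \<theta> p)
qed

text \<open>At time \<open>s\<close> no waiting time has passed, so only the starting position
  counts, and it exceeds \<open>y\<close> with Lebesgue probability \<open>1 - y\<close>.\<close>

lemma Gmap_diag:
  assumes \<theta>: "admissible \<theta>" and p: "((y, s), s) \<in> Delta T"
  shows "Gmap lam sig \<theta> ((y, s), s) = y"
proof -
  have "AE x in initial_law. ahead \<theta> ((y, s), s) x = indicator {y..<1} (snd x)"
    using AE_initial_law_snd AE_space
  proof eventually_elim
    fix x assume x: "snd x \<in> {0..<1}" "x \<in> space initial_law"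
    interpret renewal "first_rate \<theta> x" "next_rate \<theta> x" "supn T (fst x)"
      using \<theta> x by (intro renewal_rates) (auto simp: admissible_def)
    show "ahead \<theta> ((y, s), s) x = indicator {y..<1} (snd x)"
      using x p by (auto simp: ahead_def no_jump_since_diag mem_Delta indicator_def)
  qed
  then have "(\<integral>x. ahead \<theta> ((y, s), s) x \<partial>initial_law) = (\<integral>x. indicator {y..<1} (snd x) \<partial>initial_law)"
    using borel_measurable_integrable[OF ahead_integrable'[OF \<theta> p]] by (intro integral_cong_AE) auto
  then show ?thesis
    using p by (simp add: Gmap_eq' \<theta> integral_indicator_snd mem_Delta)
qed

text \<open>Almost every particle starts at \<open>z < 1\<close>. With the value 0 at
  \<open>(0, t)\<close> this gives the two end values for surjectivity.\<close>

lemma Gmap_bottom: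
  assumes \<theta>: "admissible \<theta>" and p: "((1, 0), t) \<in> Delta T"
  shows "Gmap lam sig \<theta> ((1, 0), t) = 1"
proof -
  have "AE x in initial_law. ahead \<theta> ((1, 0), t) x = 0"
    using AE_initial_law_snd by eventually_elim (auto simp: ahead_def)
  then have "(\<integral>x. ahead \<theta> ((1, 0), t) x \<partial>initial_law) = 0"
    by (rule integral_eq_zero_AE)
  then show ?thesis by (simp add: Gmap_eq' \<theta> p)
qed

lemma Gmap_lipschitz:
  assumes \<theta>: "admissible \<theta>"
  shows "(1 + 2 * mean_rate)-lipschitz_on (Delta T) (Gmap lam sig \<theta>)"
proof (rule lipschitz_onI)
  let ?G = "Gmap lam sig \<theta>"
  have main: "\<bar>?G ((y, s), t) - ?G ((y', s'), t')\<bar> \<le> \<bar>y - y'\<bar> + mean_rate * \<bar>s - s'\<bar> + mean_rate * \<bar>t - t'\<bar>"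
    if p: "((y, s), t) \<in> Delta T" "((y', s'), t') \<in> Delta T" "t \<le> t'" for y s t y' s' t'
  proof -
    have T: "t' \<le> T" using p by (simp add: mem_Delta)
    \<comment> \<open>The way from one point to the other leads through \<open>((y, s), t')\<close>:
      time changes first, then the label, at the later time, when both labels are present.\<close>
    have p': "((y, s), t') \<in> Delta T" by (rule Delta_mono[OF p(1,3) T])
    \<comment> \<open>The order on Gamma is total, so one direction of \<open>Gmap_order\<close>
      always applies.\<close>
    have "(y \<le> y' \<and> s' \<le> s) \<or> (y' \<le> y \<and> s \<le> s')"
      using p by (auto simp: mem_Delta)
    then have "\<bar>?G ((y, s), t') - ?G ((y', s'), t')\<bar> \<le> \<bar>y - y'\<bar> + mean_rate * \<bar>s - s'\<bar>"
    proof
      assume "y \<le> y' \<and> s' \<le> s"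
      then show ?thesis using Gmap_order[OF \<theta> p' p(2)] by auto
    next
      assume "y' \<le> y \<and> s \<le> s'"
      then show ?thesis using Gmap_order[OF \<theta> p(2) p'] by auto
    qed
    moreover have "\<bar>?G ((y, s), t) - ?G ((y, s), t')\<bar> \<le> mean_rate * \<bar>t - t'\<bar>"
      using Gmap_time[OF \<theta> p(1,3) T] p(3) by auto
    ultimately show ?thesis by linarith
  qed
  fix p q assume pq: "p \<in> Delta T" "q \<in> Delta T"
  obtain y s t y' s' t' where e: "p = ((y, s), t)" "q = ((y', s'), t')" by (metis prod.exhaust)
  have d: "\<bar>y - y'\<bar> \<le> dist p q" "\<bar>s - s'\<bar> \<le> dist p q" "\<bar>t - t'\<bar> \<le> dist p q"
    using dist_fst_le[of "fst p" "fst q"] dist_snd_le[of "fst p" "fst q"] dist_fst_le[of p q] dist_snd_le[of p q]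
    by (simp_all add: e dist_real_def)
  have "\<bar>?G p - ?G q\<bar> \<le> \<bar>y - y'\<bar> + mean_rate * \<bar>s - s'\<bar> + mean_rate * \<bar>t - t'\<bar>"
  proof (cases "t \<le> t'")
    case True
    then show ?thesis using main pq by (simp add: e)
  next
    case False
    then show ?thesis using main[of y' s' t' y s t] pq by (simp add: e abs_minus_commute)
  qed
  also have "\<dots> \<le> dist p q + mean_rate * dist p q + mean_rate * dist p q"
    by (intro add_mono mult_left_mono d mean_rate_nonneg)
  finally show "dist (?G p) (?G q) \<le> (1 + 2 * mean_rate) * dist p q"
    by (simp add: dist_real_def algebra_simps)
qed (simp add: mean_rate_nonneg)

lemma Gmap_admissible: "admissible \<theta> \<Longrightarrow> admissible (Gmap lam sig \<theta>)"
  using lipschitz_on_continuous_on[OF Gmap_lipschitz] Gmap_bounds by (simp add: admissible_def)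

lemma Gmap_Theta:
  assumes \<theta>: "admissible \<theta>"
  shows "Gmap lam sig \<theta> \<in> Theta T"
proof -
  let ?G = "Gmap lam sig \<theta>"
  have cont: "continuous_on (Delta T) ?G" and rng: "\<And>p. p \<in> Delta T \<Longrightarrow> ?G p \<in> {0..1}"
    using Gmap_admissible[OF \<theta>] by (auto simp: admissible_def)
  have "?G ((y0, t0), t0) = y0" if "(y0, t0) \<in> Gam T" for y0 t0
    using that T_pos by (intro Gmap_diag[OF \<theta>]) (auto simp: Gam_def mem_Delta)
  moreover have "(\<lambda>\<gamma>. ?G (\<gamma>, t)) ` Gam_t t = {0..1}" if t: "t \<in> {0..T}" for t
  proof
    show "(\<lambda>\<gamma>. ?G (\<gamma>, t)) ` Gam_t t \<subseteq> {0..1}"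
      using rng t by (auto simp: Delta_def)
    show "{0..1} \<subseteq> (\<lambda>\<gamma>. ?G (\<gamma>, t)) ` Gam_t t"
    proof
      fix v :: real assume v: "v \<in> {0..1}"
      \<comment> \<open>Parametrizes the labels by their rank \<open>r\<close> in
        \<open>{-1..t}\<close>, the inverse of \<open>grank\<close>. Along this continuous path the
        intermediate value theorem applies.\<close>
      let ?f = "\<lambda>r. ?G ((max 0 (- r), max 0 r), t)"
      have mem: "((max 0 (- r), max 0 r), t) \<in> Delta T" if "r \<in> {-1..t}" for r
        using that t by (auto simp: mem_Delta)
      have "continuous_on {-1..t} ?f"
        by (rule continuous_on_compose2[OF cont]) (auto intro!: continuous_intros mem)
      moreover have "?f (-1) = 1" using Gmap_bottom[OF \<theta>] t by (simp add: mem_Delta)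
      moreover have "?f t = 0" using Gmap_diag[OF \<theta>, of 0 t] t by (simp add: mem_Delta)
      ultimately obtain r where "r \<in> {-1..t}" "?f r = v"
        using IVT2'[of ?f t v "-1"] v t by auto
      with mem[of r] show "v \<in> (\<lambda>\<gamma>. ?G (\<gamma>, t)) ` Gam_t t"
        by (force simp: Delta_def)
    qed
  qed
  moreover have "?G (\<gamma>, t) \<le> ?G (\<gamma>', t)"
    if "t \<in> {0..T}" "\<gamma> \<in> Gam_t t" "\<gamma>' \<in> Gam_t t" "gge \<gamma> \<gamma>'" for \<gamma> \<gamma>' t
  proof -
    obtain y s y' s' where e: "\<gamma> = (y, s)" "\<gamma>' = (y', s')" by (metis prod.exhaust)
    have m: "((y, s), t) \<in> Delta T" "((y', s'), t) \<in> Delta T"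
      using that by (auto simp: Delta_def e)
    moreover have "y \<le> y'" "s' \<le> s"
      using m that(4) by (auto simp: mem_Delta gge_def grank_def e)
    ultimately show ?thesis unfolding e by (rule Gmap_order(1)[OF \<theta>])
  qed
  moreover have "?G (\<gamma>, t) \<le> ?G (\<gamma>, t')"
    if "(\<gamma>, t) \<in> Delta T" "(\<gamma>, t') \<in> Delta T" "t \<le> t'" for \<gamma> t t'
    using that by (intro Gmap_time(1)[OF \<theta>]) (auto simp: Delta_def)
  ultimately show ?thesis
    using cont rng unfolding Theta_def by blast
qed

text \<open>For each particle the rates have their own bound \<open>supn T (fst x)\<close>, and
  \<open>no_jump_since_tendsto\<close> applies. Integration over particles then only uses that
  \<open>ahead\<close> is at most 1, so nothing exponential in the norm of \<open>w\<close> is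
  integrated.\<close>

lemma Gmap_tendsto:
  assumes adm: "\<And>n. admissible (\<theta> n)" "admissible \<theta>'"
    and lim: "\<And>q. q \<in> Delta T \<Longrightarrow> (\<lambda>n. \<theta> n q) \<longlonglongrightarrow> \<theta>' q" and p: "p \<in> Delta T"
  shows "(\<lambda>n. Gmap lam sig (\<theta> n) p) \<longlonglongrightarrow> Gmap lam sig \<theta>' p"
proof -
  have rate: "(\<lambda>n. rate_at w (\<theta> n q) u) \<longlonglongrightarrow> rate_at w (\<theta>' q) u" if "w \<in> W" "q \<in> Delta T" for w q u
  proof -
    have "continuous_on UNIV (\<lambda>y. rate_at w y u)"
      by (intro rate_at_continuous that continuous_intros)
    then show ?thesis
      by (rule continuous_on_tendsto_compose) (auto intro: lim that)
  qed
  have "(\<lambda>n. \<integral>x. ahead (\<theta> n) p x \<partial>initial_law) \<longlonglongrightarrow> (\<integral>x. ahead \<theta>' p x \<partial>initial_law)"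
  proof (rule integral_dominated_convergence[where w="\<lambda>_. 1"])
    show "AE x in initial_law. norm (ahead (\<theta> n) p x) \<le> 1" for n
      using ahead_bounds[OF _ _ p, of "\<theta> n"] adm by (intro AE_I2) (auto simp: admissible_def)
    show "AE x in initial_law. (\<lambda>n. ahead (\<theta> n) p x) \<longlonglongrightarrow> ahead \<theta>' p x"
    proof (rule AE_I2)
      fix x assume x: "x \<in> space initial_law"
      then have w: "fst x \<in> W" by (auto simp: space_initial_law)
      have b: "0 \<le> snd (fst p)" "snd (fst p) \<le> snd p"
        using p by (cases p; cases "fst p"; simp add: mem_Delta)+
      have "(\<lambda>n. no_jump_since (first_rate (\<theta> n) x) (next_rate (\<theta> n) x) (snd (fst p)) (snd p))
          \<longlonglongrightarrow> no_jump_since (first_rate \<theta>' x) (next_rate \<theta>' x) (snd (fst p)) (snd p)"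
      proof (rule no_jump_since_tendsto[OF _ _ _ _ b])
        show "renewal (first_rate (\<theta> n) x) (next_rate (\<theta> n) x) (supn T (fst x))" for n
          using adm x by (intro renewal_rates) (auto simp: admissible_def)
        show "renewal (first_rate \<theta>' x) (next_rate \<theta>' x) (supn T (fst x))"
          using adm x by (intro renewal_rates) (auto simp: admissible_def)
        show "(\<lambda>n. first_rate (\<theta> n) x u) \<longlonglongrightarrow> first_rate \<theta>' x u" for u
          unfolding first_rate_def using T_pos by (intro rate w) (auto simp: mem_Delta clip_bounds)
        show "(\<lambda>n. next_rate (\<theta> n) x s u) \<longlonglongrightarrow> next_rate \<theta>' x s u" for s u
          unfolding next_rate_def using T_pos by (intro rate w) (auto simp: mem_Delta clip_bounds)
      qed
      then show "(\<lambda>n. ahead (\<theta> n) p x) \<longlonglongrightarrow> ahead \<theta>' p x"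
        unfolding ahead_def by (intro tendsto_intros)
    qed
  qed (use adm ahead_measurable in \<open>auto simp: admissible_def\<close>)
  then show ?thesis
    unfolding Gmap_eq'[OF adm(1) p] Gmap_eq'[OF adm(2) p] by (intro tendsto_intros)
qed

text \<open>A label \<open>(y, s)\<close> exists only from time \<open>s\<close> on; the maximum
  keeps the argument in \<open>Delta T\<close> and freezes the value at time \<open>s\<close> while
  \<open>t < s + d\<close>.\<close>

definition delay :: "real \<Rightarrow> ((real \<times> real) \<times> real \<Rightarrow> real) \<Rightarrow> (real \<times> real) \<times> real \<Rightarrow> real" where
  "delay d \<theta> p = \<theta> (fst p, max (snd p - d) (snd (fst p)))"

lemma delay_mem: "p \<in> Delta T \<Longrightarrow> 0 < d \<Longrightarrow> (fst p, max (snd p - d) (snd (fst p))) \<in> Delta T"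
  by (cases p; cases "fst p") (auto simp: mem_Delta)

lemma delay_admissible:
  assumes \<theta>: "admissible \<theta>" and d: "0 < d"
  shows "admissible (delay d \<theta>)"
proof -
  have "continuous_on (Delta T) (delay d \<theta>)"
    unfolding delay_def
  proof (rule continuous_on_compose2[of "Delta T" \<theta>])
    show "continuous_on (Delta T) \<theta>" using \<theta> by (simp add: admissible_def)
    show "continuous_on (Delta T) (\<lambda>p. (fst p, max (snd p - d) (snd (fst p))))"
      by (intro continuous_intros)
    show "(\<lambda>p. (fst p, max (snd p - d) (snd (fst p)))) ` Delta T \<subseteq> Delta T"
      using delay_mem[OF _ d] by (rule image_subsetI)
  qed
  then show ?thesis
    using \<theta> delay_mem[OF _ d] unfolding admissible_def delay_def by blast
qed

text \<open>On \<open>{t \<le> (k + 1) d}\<close> the map \<open>\<theta> \<mapsto> G (delay d \<theta>)\<close> only sees its argument on \<open>{t \<le> k d}\<close> and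
  the prescribed initial values, so its iterates become stationary on the bounded domain.\<close>

lemma delayed_solution_exists:
  assumes d: "0 < d"
  shows "\<exists>\<phi>. admissible \<phi> \<and> (\<forall>p\<in>Delta T. Gmap lam sig (delay d \<phi>) p = \<phi> p)"
proof -
  \<comment> \<open>The start is constant in time, with the prescribed value \<open>y\<close> at the
    label \<open>(y, s)\<close>, so \<open>diag\<close> holds from iterate 0 on.\<close>
  define \<phi> where "\<phi> k = ((\<lambda>\<theta>. Gmap lam sig (delay d \<theta>)) ^^ k) (\<lambda>p. fst (fst p))" for k
  have step: "\<phi> (Suc k) = Gmap lam sig (delay d (\<phi> k))" for k
    by (simp add: \<phi>_def)
  have adm: "admissible (\<phi> k)" for k
  proof (induction k)
    case 0
    show ?case by (auto simp: \<phi>_def admissible_def mem_Delta intro!: continuous_intros)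
  next
    case (Suc k)
    then show ?case unfolding step by (intro Gmap_admissible delay_admissible d)
  qed
  have diag: "\<phi> k ((y, s), s) = y" if "((y, s), s) \<in> Delta T" for k y s
    using that adm by (cases k) (simp add: \<phi>_def, simp add: step Gmap_diag delay_admissible d adm)
  have agree: "\<phi> (Suc k) (\<gamma>, t) = \<phi> k (\<gamma>, t)" if "(\<gamma>, t) \<in> Delta T" "t \<le> real k * d" for k \<gamma> t
    using that
  proof (induction k arbitrary: \<gamma> t)
    case 0
    \<comment> \<open>\<open>t \<le> 0\<close> leaves only labels at their own starting time 0,
      whose values are prescribed.\<close>
    then obtain y where "\<gamma> = (y, 0)" "t = 0"
      by (cases \<gamma>) (auto simp: mem_Delta)
    with 0 show ?case by (simp only: diag)
  next
    case (Suc k)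
    have "Gmap lam sig (delay d (\<phi> (Suc k))) (\<gamma>, t) = Gmap lam sig (delay d (\<phi> k)) (\<gamma>, t)"
    proof (rule Gmap_cong[OF Suc.prems(1)])
      fix \<gamma>' s assume s: "(\<gamma>', s) \<in> Delta T" "s \<le> t"
      obtain y' s' where \<gamma>': "\<gamma>' = (y', s')" by (cases \<gamma>')
      show "delay d (\<phi> (Suc k)) (\<gamma>', s) = delay d (\<phi> k) (\<gamma>', s)"
      proof (cases "s' \<le> s - d")
        case True
        then have "(\<gamma>', s - d) \<in> Delta T" using s d by (auto simp: \<gamma>' mem_Delta)
        moreover have "s - d \<le> real k * d" using s Suc.prems by (simp add: algebra_simps)
        ultimately have "\<phi> (Suc k) (\<gamma>', s - d) = \<phi> k (\<gamma>', s - d)" by (rule Suc.IH)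
        with True show ?thesis by (simp add: delay_def \<gamma>' max_absorb1)
      next
        \<comment> \<open>The delayed time is the starting time \<open>s'\<close>, where all
          iterates take the value \<open>y'\<close>.\<close>
        case False
        then have "((y', s'), s') \<in> Delta T" using s by (auto simp: \<gamma>' mem_Delta)
        then have "\<phi> (Suc k) ((y', s'), s') = \<phi> k ((y', s'), s')" by (simp only: diag)
        with False show ?thesis by (simp add: delay_def \<gamma>' max_absorb2)
      qed
    qed
    then show ?case by (simp only: step)
  qed
  obtain N where N: "T \<le> real N * d"
    using reals_Archimedean3[OF d] less_imp_le by blast
  have "Gmap lam sig (delay d (\<phi> N)) p = \<phi> N p" if p: "p \<in> Delta T" for p
  proof -
    obtain \<gamma> t where e: "p = (\<gamma>, t)" by (cases p)
    with p have "t \<le> T" by (simp add: Delta_def)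
    with N have "t \<le> real N * d" by (rule order_trans[rotated])
    with p have "\<phi> (Suc N) p = \<phi> N p" unfolding e by (rule agree)
    then show ?thesis by (simp only: step)
  qed
  with adm show ?thesis by blast
qed

theorem Gmap_fixed_point: "\<exists>\<theta>\<in>Theta T. \<forall>p\<in>Delta T. Gmap lam sig \<theta> p = \<theta> p"
proof -
  define d where "d n = 1 / real (Suc n)" for n
  have d: "0 < d n" for n by (simp add: d_def)
  have "\<forall>n. \<exists>\<phi>. admissible \<phi> \<and> (\<forall>p\<in>Delta T. Gmap lam sig (delay (d n) \<phi>) p = \<phi> p)"
    using delayed_solution_exists[OF d] by blast
  then obtain \<phi> where adm: "\<And>n. admissible (\<phi> n)"
    and sol: "\<And>n p. p \<in> Delta T \<Longrightarrow> Gmap lam sig (delay (d n) (\<phi> n)) p = \<phi> n p"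
    by metis
  define L where "L = 1 + 2 * mean_rate"
  have "0 < L" using mean_rate_nonneg by (simp add: L_def)
  \<comment> \<open>Each \<open>\<phi> n\<close> is an image under \<open>Gmap\<close> on
    \<open>Delta T\<close>, so the constant depends neither on \<open>n\<close> nor on the
    delay.\<close>
  have lip: "\<bar>\<phi> n p - \<phi> n q\<bar> \<le> L * dist p q" if "p \<in> Delta T" "q \<in> Delta T" for n p q
    using lipschitz_onD[OF Gmap_lipschitz[OF delay_admissible[OF adm[of n] d[of n]]] that] that
    by (simp add: sol dist_real_def L_def)
  obtain g k where g: "continuous_on (Delta T) g" and k: "strict_mono (k :: nat \<Rightarrow> nat)"
    and unif: "\<And>e. 0 < e \<Longrightarrow> \<exists>N. \<forall>n x. n \<ge> N \<and> x \<in> Delta T \<longrightarrow> norm (\<phi> (k n) x - g x) < e"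
  proof (rule Arzela_Ascoli[OF compact_Delta])
    show "norm (\<phi> n x) \<le> 1" if "x \<in> Delta T" for n x
      using adm[of n] that by (auto simp: admissible_def)
    show "\<exists>r>0. \<forall>n y. y \<in> Delta T \<and> norm (x - y) < r \<longrightarrow> norm (\<phi> n x - \<phi> n y) < e"
      if "x \<in> Delta T" "0 < e" for x e
    proof (intro exI[of _ "e / L"] conjI allI impI)
      show "0 < e / L" using that \<open>0 < L\<close> by simp
      fix n y assume y: "y \<in> Delta T \<and> norm (x - y) < e / L"
      then have "L * dist x y < e"
        using \<open>0 < L\<close> by (simp add: dist_norm pos_less_divide_eq mult.commute)
      with lip[OF that(1), of y n] y show "norm (\<phi> n x - \<phi> n y) < e" by simp
    qed
  qed blast
  have lim: "(\<lambda>n. \<phi> (k n) p) \<longlonglongrightarrow> g p" if "p \<in> Delta T" for p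
  proof (rule LIMSEQ_I)
    fix e :: real assume "0 < e"
    then show "\<exists>N. \<forall>n\<ge>N. norm (\<phi> (k n) p - g p) < e"
      using unif that by blast
  qed
  have "g p \<in> {0..1}" if "p \<in> Delta T" for p
    using closed_sequentially[of "{0..1}" "\<lambda>n. \<phi> (k n) p" "g p"] lim[OF that] adm that
    by (auto simp: admissible_def)
  with g have adm_g: "admissible g" by (simp add: admissible_def)
  have "d \<longlonglongrightarrow> 0"
    unfolding d_def using LIMSEQ_inverse_real_of_nat by (simp add: inverse_eq_divide)
  then have "(\<lambda>n. d (k n)) \<longlonglongrightarrow> 0"
    using LIMSEQ_subseq_LIMSEQ[OF _ k] by (simp add: o_def)
  then have d0: "(\<lambda>n. L * d (k n)) \<longlonglongrightarrow> 0"
    by (rule tendsto_mult_right_zero)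
  have delay_lim: "(\<lambda>n. delay (d (k n)) (\<phi> (k n)) p) \<longlonglongrightarrow> g p" if p: "p \<in> Delta T" for p
  proof -
    have "\<bar>delay (d (k n)) (\<phi> (k n)) p - \<phi> (k n) p\<bar> \<le> L * d (k n)" for n
    proof -
      have "snd (fst p) \<le> snd p" using p by (cases p; cases "fst p") (simp add: mem_Delta)
      \<comment> \<open>The delay moves the time argument by at most \<open>d (k n)\<close>, so
        equi-Lipschitz continuity makes its effect vanish in the limit.\<close>
      then have "dist (fst p, max (snd p - d (k n)) (snd (fst p))) p \<le> d (k n)"
        using d[of "k n"] by (cases p) (auto simp: dist_Pair_Pair dist_real_def)
      then have "L * dist (fst p, max (snd p - d (k n)) (snd (fst p))) p \<le> L * d (k n)"
        using \<open>0 < L\<close> by simp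
      then show ?thesis
        unfolding delay_def using lip[OF delay_mem[OF p d] p, of "k n" "k n"] by linarith
    qed
    then have "(\<lambda>n. delay (d (k n)) (\<phi> (k n)) p - \<phi> (k n) p) \<longlonglongrightarrow> 0"
      by (intro Lim_null_comparison[OF _ d0]) simp
    from tendsto_add[OF this lim[OF p]] show ?thesis by simp
  qed
  have fix_g: "Gmap lam sig g p = g p" if "p \<in> Delta T" for p
  proof (rule LIMSEQ_unique)
    show "(\<lambda>n. Gmap lam sig (delay (d (k n)) (\<phi> (k n))) p) \<longlonglongrightarrow> Gmap lam sig g p"
      by (rule Gmap_tendsto) (use delay_admissible adm d adm_g delay_lim that in auto)
    show "(\<lambda>n. Gmap lam sig (delay (d (k n)) (\<phi> (k n))) p) \<longlonglongrightarrow> g p"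
      using lim that by (simp add: sol)
  qed
  \<comment> \<open>The witness is \<open>Gmap lam sig g\<close>, whose membership in
    \<open>Theta T\<close> is given by \<open>Gmap_Theta\<close>; it agrees with \<open>g\<close> on
    \<open>Delta T\<close>, so \<open>Gmap_cong\<close> carries the equation over.\<close>
  have "Gmap lam sig (Gmap lam sig g) p = Gmap lam sig g p" if "p \<in> Delta T" for p
    using Gmap_cong[of "fst p" "snd p" T "Gmap lam sig g" g lam sig] that fix_g by simp
  with Gmap_Theta[OF adm_g] show ?thesis by blast
qed

end

theorem theoremA1:
  fixes T :: real
    and W :: "(real \<times> real \<Rightarrow> real) set"
    and lam :: "(real \<times> real \<Rightarrow> real) measure"
    and sig :: "(real \<times> real \<Rightarrow> real) \<Rightarrow> real \<Rightarrow> real"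
  assumes T_pos: "T > 0"
    and W_C1: "\<forall>w\<in>W. C1_on (rect T) w \<and> (\<forall>p\<in>rect T. w p \<ge> 0)"
    and space_lam: "space lam = W"
    and sets_lam: "sets lam = sigma_sets W {U. supopen T W U}"
    and prob: "prob_space lam"
    and M_W: "integrable lam (supn T)"
    and C'_W: "\<exists>C. \<forall>w\<in>W. \<forall>p\<in>rect T. \<forall>q\<in>rect T. \<bar>w p - w q\<bar> \<le> C"
    and sig_meas: "(\<lambda>(w, y). sig w y) \<in> borel_measurable (lam \<Otimes>\<^sub>M restrict_space lborel {0..1})"
    and sig_nonneg: "\<forall>w\<in>W. \<forall>y\<in>{0..1}. sig w y \<ge> 0"
    and sig_int_w: "\<forall>y\<in>{0..1}. (\<integral>\<^sup>+ w. ennreal (sig w y) \<partial>lam) = 1"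
    and sig_int_z: "\<forall>w\<in>W. (\<integral>\<^sup>+ z\<in>{0..1}. ennreal (sig w z) \<partial>lborel) = 1"
  shows "\<exists>\<theta>\<in>Theta T. \<forall>p\<in>Delta T. Gmap lam sig \<theta> p = \<theta> p"
proof -
  have "continuous_on (rect T) w" if "w \<in> W" for w
  proof -
    obtain D where "\<And>x. x \<in> rect T \<Longrightarrow> (w has_derivative (\<lambda>h. D x \<bullet> h)) (at x within rect T)"
      using W_C1 \<open>w \<in> W\<close> unfolding C1_on_def by blast
    then show ?thesis by (rule has_derivative_continuous_on)
  qed
  then interpret particle_system T W lam sig
    using assms by (intro particle_system.intro) auto
  show ?thesis by (rule Gmap_fixed_point)
qed

end
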